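(* Let $T=((\Omega,\mathcal{A}),\{(\Omega,\mathcal{M}_i)\}_{i\in N},\{t_i\}_{i\in N})$ be a type space. Then exactly one of the following holds: (a) the players' beliefs in $T$ are strongly consistent; (b) there exists an acceptable bet in $T$.
   Context: A field on a set $X$ is a collection of subsets of $X$ containing $X$ and closed under complements and finite intersections. For a field $\mathcal{A}$ on $\Omega$, $\mathrm{pba}(\Omega,\mathcal{A})$ is the set of finitely additive nonnegative $P:\mathcal{A}\to\mathbb{R}$ with $P(\Omega)=1$; $\mathrm{ba}(\Omega,\mathcal{A})$ the bounded finitely additive real set functions on $\mathcal{A}$; $B(\Omega,\mathcal{A})$ the sup-norm closure of the linear span of indicators of sets in $\mathcal{A}$. $\mathrm{ba}(\Omega,\mathcal{A})$ carries the weak* topology (weakest making $\mu\mapsto\int f\,d\mu$ continuous for all $f\in B(\Omega,\mathcal{A})$), finite powers $\mathrm{ba}(\Omega,\mathcal{A})^k$ the product topology; $\overline{\,\cdot\,}^\ast$ denotes closure in it. $\mathrm{conv}$ is convex hull, $\mathrm{cone}(C)=\{\beta x:\beta\ge0,x\in C\}$, $\mathrm{diag}\,C^k=\{(x,\dots,x):x\in C\}$. A type space is $T=((\Omega,\mathcal{A}),\{(\Omega,\mathcal{M}_i)\}_{i\in N},\{t_i\}_{i\in N})$ with $N$ a nonempty set of players, fields $\mathcal{M}_i\subseteq\mathcal{A}$ on a set $\Omega$, and $t_i:\Omega\times\mathcal{A}\to[0,1]$ with: $t_i(\omega,\cdot)\in\mathrm{pba}(\Omega,\mathcal{A})$; $t_i(\cdot,E)\in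 B(\Omega,\mathcal{M}_i)$ for all $E\in\mathcal{A}$; $t_i(\omega,E)=1$ whenever $E\in\mathcal{M}_i$, $\omega\in E$. Let $\Pi_i=\overline{\mathrm{conv}\{t_i(\omega,\cdot):\omega\in\Omega\}}^\ast$ and, for $\omega^\ast\in\Omega$, $\Pi_i^{-\omega^\ast}=\overline{\mathrm{conv}\{t_i(\omega,\cdot):\omega\in\Omega,\ t_i(\omega,\cdot)\ne t_i(\omega^\ast,\cdot)\}}^\ast$. The players' beliefs are strongly consistent if for every finite $I\subseteq N$, every $i^\ast\in I$ and every $\omega^\ast\in\Omega$, $t_{i^\ast}(\omega^\ast,\cdot)\in\overline{\mathrm{cone}\big(\prod_{i\in I\setminus\{i^\ast\}}\Pi_i\big)-\mathrm{cone}\big(\mathrm{diag}(\Pi_{i^\ast}^{-\omega^\ast})^{|I|-1}\big)}^\ast$, where $t_{i^\ast}(\omega^\ast,\cdot)$ is identified with the element of $\mathrm{ba}(\Omega,\mathcal{A})^{I\setminus\{i^\ast\}}$ all of whose coordinates equal it. For $I\subseteq N$, a nonempty $S\subseteq\Omega$ is an $I$-common certainty component if there is $E\in\mathcal{A}$ with $E\subseteq S$ and $t_i(\omega,E)=1$ for all $\omega\in S$, $i\in I$; a set $E$ is $I$-commonly certain at $\omega$ if there is such $S$ with $\omega\in S\subseteq E$. A bet is a family $(f_i)_{i\in I}$, $I\subseteq N$ finite, $f_i\in B(\Omega,\mathcal{A})$, with $\sum_{i\in I}f_i(\omega)=0$ for all $\omega$. A bet is acceptable if for every $\omega\in\Omega$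 the set $\{\omega':\int f_i\,dt_i(\omega',\cdot)\ge0\ \forall i\in I\}$ is $I$-commonly certain at $\omega$, and there exist $\omega^\ast\in\Omega$, $i^\ast\in I$ with $\int f_{i^\ast}\,dt_{i^\ast}(\omega^\ast,\cdot)>0$.
   Formalization: Here cone(C) always contains 0, so cone(∅)={0}; with the literal cone(∅)=∅ the claim fails for a one-state type space, where Π_i^{-ω*} is empty and neither (a) nor (b) holds. For nonempty C nothing changes. *)

theory Defs
  imports "HOL-Analysis.Analysis"
begin

definition is_field :: "'w set \<Rightarrow> 'w set set \<Rightarrow> bool" where
  "is_field \<Omega> \<A> \<longleftrightarrow> \<A> \<subseteq> Pow \<Omega> \<and> \<Omega> \<in> \<A>
     \<and> (\<forall>E\<in>\<A>. \<Omega> - E \<in> \<A>) \<and> (\<forall>E\<in>\<A>. \<forall>F\<in>\<A>. E \<inter> F \<in> \<A>)"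

text \<open>Set functions on the field A are represented as total functions on sets
  that vanish outside A (so that equality of elements of ba means equality on A).\<close>

definition on_field :: "'w set set \<Rightarrow> ('w set \<Rightarrow> real) \<Rightarrow> ('w set \<Rightarrow> real)" where
  "on_field \<A> \<mu> = (\<lambda>E. if E \<in> \<A> then \<mu> E else 0)"

definition fin_additive :: "'w set set \<Rightarrow> ('w set \<Rightarrow> real) \<Rightarrow> bool" where
  "fin_additive \<A> \<mu> \<longleftrightarrow>
     (\<forall>E\<in>\<A>. \<forall>F\<in>\<A>. E \<inter> F = {} \<longrightarrow> \<mu> (E \<union> F) = \<mu> E + \<mu> F)"

definition ba :: "'w set \<Rightarrow> 'w set set \<Rightarrow> ('w set \<Rightarrow> real) set" where
  "ba \<Omega> \<A> = {\<mu>. fin_additive \<A> \<mu> \<and> (\<exists>K. \<forall>E\<in>\<A>. \<bar>\<mu> E\<bar> \<le> K)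
                 \<and> (\<forall>E. E \<notin> \<A> \<longrightarrow> \<mu> E = 0)}"

definition pba :: "'w set \<Rightarrow> 'w set set \<Rightarrow> ('w set \<Rightarrow> real) set" where
  "pba \<Omega> \<A> = {\<mu>. fin_additive \<A> \<mu> \<and> (\<forall>E\<in>\<A>. \<mu> E \<ge> 0) \<and> \<mu> \<Omega> = 1}"

definition simple_fun :: "(real \<times> 'w set) list \<Rightarrow> 'w \<Rightarrow> real" where
  "simple_fun xs \<omega> = (\<Sum>(c, E)\<leftarrow>xs. c * indicator E \<omega>)"

definition simple_int :: "('w set \<Rightarrow> real) \<Rightarrow> (real \<times> 'w set) list \<Rightarrow> real" where
  "simple_int \<mu> xs = (\<Sum>(c, E)\<leftarrow>xs. c * \<mu> E)"

definition Bfun :: "'w set \<Rightarrow> 'w set set \<Rightarrow> ('w \<Rightarrow> real) set" where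
  "Bfun \<Omega> \<A> = {f. \<forall>\<epsilon>>0. \<exists>xs. set (map snd xs) \<subseteq> \<A>
                     \<and> (\<forall>\<omega>\<in>\<Omega>. \<bar>f \<omega> - simple_fun xs \<omega>\<bar> \<le> \<epsilon>)}"

definition fa_integral ::
  "'w set \<Rightarrow> 'w set set \<Rightarrow> ('w set \<Rightarrow> real) \<Rightarrow> ('w \<Rightarrow> real) \<Rightarrow> real" where
  "fa_integral \<Omega> \<A> \<mu> f = (THE r. \<forall>\<epsilon>>0. \<exists>\<delta>>0. \<forall>xs. set (map snd xs) \<subseteq> \<A>
       \<and> (\<forall>\<omega>\<in>\<Omega>. \<bar>f \<omega> - simple_fun xs \<omega>\<bar> \<le> \<delta>) \<longrightarrow> \<bar>r - simple_int \<mu> xs\<bar> \<le> \<epsilon>)"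

definition weakstar :: "'w set \<Rightarrow> 'w set set \<Rightarrow> ('w set \<Rightarrow> real) topology" where
  "weakstar \<Omega> \<A> = topology_generated_by
     {{\<mu> \<in> ba \<Omega> \<A>. fa_integral \<Omega> \<A> \<mu> f \<in> U} | f U. f \<in> Bfun \<Omega> \<A> \<and> open U}"

definition ba_conv :: "('w set \<Rightarrow> real) set \<Rightarrow> ('w set \<Rightarrow> real) set" where
  "ba_conv S = {(\<lambda>E. \<Sum>k<n. c k * \<mu> k E) | (n::nat) c \<mu>.
                  (\<forall>k<n. c k \<ge> 0 \<and> \<mu> k \<in> S) \<and> (\<Sum>k<n. c k) = 1}"

text \<open>Elements of ba^J (J finite) are functions on J, extensional outside J.
  Cones are taken with the convention that they always contain 0
  (which agrees with the paper's definition for nonempty sets).\<close>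

definition cone_prod :: "'i set \<Rightarrow> ('i \<Rightarrow> ('w set \<Rightarrow> real) set)
                         \<Rightarrow> ('i \<Rightarrow> 'w set \<Rightarrow> real) set" where
  "cone_prod J P = {restrict (\<lambda>j. \<lambda>E. \<beta> * x j E) J | \<beta> x. \<beta> \<ge> 0 \<and> x \<in> PiE J P}
                   \<union> {restrict (\<lambda>j. \<lambda>E. 0) J}"

definition cone_diag :: "'i set \<Rightarrow> ('w set \<Rightarrow> real) set \<Rightarrow> ('i \<Rightarrow> 'w set \<Rightarrow> real) set" where
  "cone_diag J C = {restrict (\<lambda>j. \<lambda>E. \<beta> * y E) J | \<beta> y. \<beta> \<ge> 0 \<and> y \<in> C}
                   \<union> {restrict (\<lambda>j. \<lambda>E. 0) J}"

definition tuple_minus :: "'i set \<Rightarrow> ('i \<Rightarrow> 'w set \<Rightarrow> real) set \<Rightarrow> ('i \<Rightarrow> 'w set \<Rightarrow> real) set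
                           \<Rightarrow> ('i \<Rightarrow> 'w set \<Rightarrow> real) set" where
  "tuple_minus J X Y = {restrict (\<lambda>j. \<lambda>E. u j E - v j E) J | u v. u \<in> X \<and> v \<in> Y}"

definition type_space ::
  "'w set \<Rightarrow> 'w set set \<Rightarrow> 'i set \<Rightarrow> ('i \<Rightarrow> 'w set set) \<Rightarrow> ('i \<Rightarrow> 'w \<Rightarrow> 'w set \<Rightarrow> real) \<Rightarrow> bool"
  where
  "type_space \<Omega> \<A> N \<M> t \<longleftrightarrow> N \<noteq> {} \<and> is_field \<Omega> \<A> \<and>
     (\<forall>i\<in>N. is_field \<Omega> (\<M> i) \<and> \<M> i \<subseteq> \<A> \<and>
        (\<forall>\<omega>\<in>\<Omega>. on_field \<A> (t i \<omega>) \<in> pba \<Omega> \<A>) \<and>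
        (\<forall>E\<in>\<A>. (\<lambda>\<omega>. t i \<omega> E) \<in> Bfun \<Omega> (\<M> i)) \<and>
        (\<forall>E\<in>\<M> i. \<forall>\<omega>\<in>E. t i \<omega> E = 1))"

definition ttype :: "'w set set \<Rightarrow> ('i \<Rightarrow> 'w \<Rightarrow> 'w set \<Rightarrow> real) \<Rightarrow> 'i \<Rightarrow> 'w \<Rightarrow> ('w set \<Rightarrow> real)"
  where "ttype \<A> t i \<omega> = on_field \<A> (t i \<omega>)"

definition PiT :: "'w set \<Rightarrow> 'w set set \<Rightarrow> ('i \<Rightarrow> 'w \<Rightarrow> 'w set \<Rightarrow> real) \<Rightarrow> 'i \<Rightarrow> ('w set \<Rightarrow> real) set"
  where "PiT \<Omega> \<A> t i = weakstar \<Omega> \<A> closure_of ba_conv (ttype \<A> t i ` \<Omega>)"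

definition PiT_minus :: "'w set \<Rightarrow> 'w set set \<Rightarrow> ('i \<Rightarrow> 'w \<Rightarrow> 'w set \<Rightarrow> real) \<Rightarrow> 'i \<Rightarrow> 'w
                         \<Rightarrow> ('w set \<Rightarrow> real) set"
  where "PiT_minus \<Omega> \<A> t i \<omega>0 = weakstar \<Omega> \<A> closure_of
           ba_conv (ttype \<A> t i ` {\<omega> \<in> \<Omega>. ttype \<A> t i \<omega> \<noteq> ttype \<A> t i \<omega>0})"

definition strongly_consistent ::
  "'w set \<Rightarrow> 'w set set \<Rightarrow> 'i set \<Rightarrow> ('i \<Rightarrow> 'w \<Rightarrow> 'w set \<Rightarrow> real) \<Rightarrow> bool" where
  "strongly_consistent \<Omega> \<A> N t \<longleftrightarrow>
     (\<forall>I i0 \<omega>0. finite I \<and> I \<subseteq> N \<and> i0 \<in> I \<and> \<omega>0 \<in> \<Omega> \<longrightarrow>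
        restrict (\<lambda>_. ttype \<A> t i0 \<omega>0) (I - {i0}) \<in>
          product_topology (\<lambda>_. weakstar \<Omega> \<A>) (I - {i0}) closure_of
            tuple_minus (I - {i0}) (cone_prod (I - {i0}) (PiT \<Omega> \<A> t))
                                   (cone_diag (I - {i0}) (PiT_minus \<Omega> \<A> t i0 \<omega>0)))"

definition cc_component ::
  "'w set \<Rightarrow> 'w set set \<Rightarrow> ('i \<Rightarrow> 'w \<Rightarrow> 'w set \<Rightarrow> real) \<Rightarrow> 'i set \<Rightarrow> 'w set \<Rightarrow> bool" where
  "cc_component \<Omega> \<A> t I S \<longleftrightarrow> S \<noteq> {} \<and> S \<subseteq> \<Omega> \<and>
     (\<exists>E\<in>\<A>. E \<subseteq> S \<and> (\<forall>\<omega>\<in>S. \<forall>i\<in>I. t i \<omega> E = 1))"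

definition commonly_certain ::
  "'w set \<Rightarrow> 'w set set \<Rightarrow> ('i \<Rightarrow> 'w \<Rightarrow> 'w set \<Rightarrow> real) \<Rightarrow> 'i set \<Rightarrow> 'w set \<Rightarrow> 'w \<Rightarrow> bool" where
  "commonly_certain \<Omega> \<A> t I E \<omega> \<longleftrightarrow> (\<exists>S. cc_component \<Omega> \<A> t I S \<and> \<omega> \<in> S \<and> S \<subseteq> E)"

definition is_bet ::
  "'w set \<Rightarrow> 'w set set \<Rightarrow> 'i set \<Rightarrow> 'i set \<Rightarrow> ('i \<Rightarrow> 'w \<Rightarrow> real) \<Rightarrow> bool" where
  "is_bet \<Omega> \<A> N I f \<longleftrightarrow> finite I \<and> I \<subseteq> N \<and> (\<forall>i\<in>I. f i \<in> Bfun \<Omega> \<A>)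
     \<and> (\<forall>\<omega>\<in>\<Omega>. (\<Sum>i\<in>I. f i \<omega>) = 0)"

definition acceptable_bet ::
  "'w set \<Rightarrow> 'w set set \<Rightarrow> 'i set \<Rightarrow> ('i \<Rightarrow> 'w \<Rightarrow> 'w set \<Rightarrow> real) \<Rightarrow> 'i set
   \<Rightarrow> ('i \<Rightarrow> 'w \<Rightarrow> real) \<Rightarrow> bool" where
  "acceptable_bet \<Omega> \<A> N t I f \<longleftrightarrow> is_bet \<Omega> \<A> N I f \<and>
     (\<forall>\<omega>\<in>\<Omega>. commonly_certain \<Omega> \<A> t I
        {\<omega>' \<in> \<Omega>. \<forall>i\<in>I. fa_integral \<Omega> \<A> (ttype \<A> t i \<omega>') (f i) \<ge> 0} \<omega>) \<and>
     (\<exists>\<omega>0\<in>\<Omega>. \<exists>i0\<in>I. fa_integral \<Omega> \<A> (ttype \<A> t i0 \<omega>0) (f i0) > 0)"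

end

theory Submission
  imports Defs
begin

text \<open>The whole space is an \<open>I\<close>-common certainty component, and a bet is acceptable exactly when all
  expectations are nonnegative everywhere and one of them is positive somewhere. Such a bet is
  a weak* continuous functional on the tuples indexed by \<open>I - {i*}\<close>: it is nonnegative on the
  difference of cones and negative at the type of \<open>i*\<close> at \<open>\<omega>*\<close>, which contradicts strong
  consistency. Conversely, if that type lies outside the closure, then a basic neighbourhood of it,
  given by finitely many functionals, misses the cones over the convex hulls themselves, so a
  separation in finite dimension suffices. It yields functions \<open>h\<^sub>j\<close> for the other players;
  subtracting the infimum of the expectation of each \<open>h\<^sub>j\<close> over the types of \<open>j\<close>, and letting \<open>i*\<close>
  take the opposite side, gives the bet. The infima have a nonnegative sum because the separating
  functional is nonnegative on all tuples of types.\<close>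

subsection \<open>Finitely additive integrals\<close>

lemma simple_int_cong:
  "(\<And>E. E \<in> set (map snd xs) \<Longrightarrow> \<mu> E = \<nu> E) \<Longrightarrow> simple_int \<mu> xs = simple_int \<nu> xs"
  unfolding simple_int_def by (intro arg_cong[of _ _ sum_list] map_cong) (force split: prod.splits)+

lemma simple_fun_append: "simple_fun (xs @ ys) \<omega> = simple_fun xs \<omega> + simple_fun ys \<omega>"
  by (simp add: simple_fun_def)

lemma simple_int_append: "simple_int \<mu> (xs @ ys) = simple_int \<mu> xs + simple_int \<mu> ys"
  by (simp add: simple_int_def)

lemma simple_fun_scale: "simple_fun (map (\<lambda>(c, E). (a * c, E)) xs) \<omega> = a * simple_fun xs \<omega>"
  by (induction xs) (auto simp: simple_fun_def algebra_simps)

lemma simple_int_scale: "simple_int \<mu> (map (\<lambda>(c, E). (a * c, E)) xs) = a * simple_int \<mu> xs"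
  by (induction xs) (auto simp: simple_int_def algebra_simps)

lemma simple_int_measure_add: "simple_int (\<lambda>E. \<mu> E + \<nu> E) xs = simple_int \<mu> xs + simple_int \<nu> xs"
  by (induction xs) (auto simp: simple_int_def algebra_simps)

lemma simple_int_measure_scale: "simple_int (\<lambda>E. a * \<mu> E) xs = a * simple_int \<mu> xs"
  by (induction xs) (auto simp: simple_int_def algebra_simps)

text \<open>Serves to prove the additivity and homogeneity laws of the integral, where both sides
  are compared through a simple function with uniform error \<delta>. If the distance were positive,
  the choice of \<delta> as the distance divided by \<open>2 * C\<close> would halve it; the case
  \<delta> = 1 shows that \<open>C\<close> is then positive.\<close>

lemma eq_by_approx:
  fixes a b C :: real
  assumes "\<And>\<delta>. \<delta> > 0 \<Longrightarrow> \<bar>a - b\<bar> \<le> C * \<delta>"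
  shows "a = b"
proof (rule ccontr)
  assume "a \<noteq> b"
  have "C > 0" using assms[of 1] \<open>a \<noteq> b\<close> by simp
  then have "\<bar>a - b\<bar> \<le> C * (\<bar>a - b\<bar> / (2 * C))"
    using \<open>a \<noteq> b\<close> by (intro assms) simp
  then show False using \<open>a \<noteq> b\<close> \<open>C > 0\<close> by simp
qed

section \<open>Fields of sets and finitely additive set functions\<close>

locale set_field =
  fixes \<Omega> :: "'w set" and \<A> :: "'w set set"
  assumes field: "is_field \<Omega> \<A>"
begin

lemma sets_subset: "E \<in> \<A> \<Longrightarrow> E \<subseteq> \<Omega>"
  using field by (auto simp: is_field_def)

lemma space_in: "\<Omega> \<in> \<A>"
  using field by (auto simp: is_field_def)

lemma compl_in: "E \<in> \<A> \<Longrightarrow> \<Omega> - E \<in> \<A>"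
  using field by (auto simp: is_field_def)

lemma inter_in: "E \<in> \<A> \<Longrightarrow> F \<in> \<A> \<Longrightarrow> E \<inter> F \<in> \<A>"
  using field by (auto simp: is_field_def)

lemma empty_in: "{} \<in> \<A>"
  using compl_in[OF space_in] by simp

lemma diff_in:
  assumes "E \<in> \<A>" "F \<in> \<A>"
  shows "E - F \<in> \<A>"
proof -
  have "E - F = E \<inter> (\<Omega> - F)"
    using sets_subset[OF assms(1)] by auto
  then show ?thesis
    using inter_in[OF assms(1) compl_in[OF assms(2)]] by simp
qed

lemma union_in:
  assumes "E \<in> \<A>" "F \<in> \<A>"
  shows "E \<union> F \<in> \<A>"
proof -
  have "E \<union> F = \<Omega> - ((\<Omega> - E) \<inter> (\<Omega> - F))"
    using sets_subset assms by auto
  then show ?thesis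
    using compl_in[OF inter_in[OF compl_in[OF assms(1)] compl_in[OF assms(2)]]] by simp
qed

lemma fin_additiveD:
  "fin_additive \<A> \<mu> \<Longrightarrow> E \<in> \<A> \<Longrightarrow> F \<in> \<A> \<Longrightarrow> E \<inter> F = {} \<Longrightarrow> \<mu> (E \<union> F) = \<mu> E + \<mu> F"
  by (auto simp: fin_additive_def)

lemma fin_additive_empty: "fin_additive \<A> \<mu> \<Longrightarrow> \<mu> {} = 0"
  using fin_additiveD[of \<mu> "{}" "{}"] empty_in by simp

lemma fin_additive_split:
  assumes "fin_additive \<A> \<mu>" "E \<in> \<A>" "F \<in> \<A>"
  shows "\<mu> F = \<mu> (F \<inter> E) + \<mu> (F - E)"
proof -
  have "\<mu> ((F \<inter> E) \<union> (F - E)) = \<mu> (F \<inter> E) + \<mu> (F - E)"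
    by (intro fin_additiveD assms inter_in diff_in) auto
  moreover have "(F \<inter> E) \<union> (F - E) = F" by auto
  ultimately show ?thesis by simp
qed

text \<open>Here \<open>A\<close> and \<open>B\<close> collect the atoms of \<open>F\<close> of positive and of negative measure, so
  that \<open>\<mu> A - \<mu> B\<close> plays the role of the variation on \<open>F\<close>. The constant \<open>d\<close> is needed
  for the induction: it absorbs the coefficient of the set that splits \<open>F\<close>.\<close>

lemma simple_int_le_variation:
  assumes \<mu>: "fin_additive \<A> \<mu>" and "M \<ge> 0"
  shows "set (map snd xs) \<subseteq> \<A> \<Longrightarrow> F \<in> \<A> \<Longrightarrow> (\<And>\<omega>. \<omega> \<in> F \<Longrightarrow> \<bar>d + simple_fun xs \<omega>\<bar> \<le> M) \<Longrightarrow>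
    \<exists>A\<in>\<A>. \<exists>B\<in>\<A>. A \<subseteq> F \<and> B \<subseteq> F \<and>
      \<bar>d * \<mu> F + simple_int (\<lambda>E. \<mu> (E \<inter> F)) xs\<bar> \<le> M * (\<mu> A - \<mu> B)"
proof (induction xs arbitrary: F d)
  case Nil
  \<comment> \<open>The bound on \<bar>d\<bar> comes from evaluating at a point of \<open>F\<close>;
    if there is none, the measure of \<open>F\<close> is 0.\<close>
  have "\<bar>d * \<mu> F\<bar> \<le> M * \<bar>\<mu> F\<bar>"
  proof (cases "F = {}")
    case True
    then show ?thesis using fin_additive_empty[OF \<mu>] by simp
  next
    case False
    then obtain \<omega> where "\<omega> \<in> F" by auto
    then have "\<bar>d\<bar> \<le> M" using Nil.prems(3)[of \<omega>] by (simp add: simple_fun_def)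
    then show ?thesis by (simp add: abs_mult mult_right_mono)
  qed
  moreover have "\<exists>A\<in>\<A>. \<exists>B\<in>\<A>. A \<subseteq> F \<and> B \<subseteq> F \<and> \<bar>\<mu> F\<bar> = \<mu> A - \<mu> B"
  proof (cases "\<mu> F \<ge> 0")
    case True
    then show ?thesis
      using fin_additive_empty[OF \<mu>] Nil empty_in by (intro bexI[of _ F] bexI[of _ "{}"]) auto
  next
    case False
    then show ?thesis
      using fin_additive_empty[OF \<mu>] Nil empty_in by (intro bexI[of _ "{}"] bexI[of _ F]) auto
  qed
  ultimately obtain A B where "A \<in> \<A>" "B \<in> \<A>" "A \<subseteq> F" "B \<subseteq> F" "\<bar>d * \<mu> F\<bar> \<le> M * (\<mu> A - \<mu> B)"
    by metis
  then show ?case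
    by (intro bexI[of _ A] bexI[of _ B] conjI) (simp_all add: simple_int_def)
next
  case (Cons x xs)
  obtain c E where x: "x = (c, E)" by force
  have E: "E \<in> \<A>" and xs: "set (map snd xs) \<subseteq> \<A>" using Cons.prems(1) x by auto
  have F: "F \<in> \<A>" by fact
  \<comment> \<open>On \<open>F \<inter> E\<close> the first indicator is constantly 1 and on
    \<open>F - E\<close> it is constantly 0, so the shorter list satisfies the bound on both pieces,
    with constants \<open>d + c\<close> and \<open>d\<close>.\<close>
  have 1: "\<bar>(d + c) + simple_fun xs \<omega>\<bar> \<le> M" if "\<omega> \<in> F \<inter> E" for \<omega>
    using Cons.prems(3)[of \<omega>] that x by (simp add: simple_fun_def algebra_simps)
  have 2: "\<bar>d + simple_fun xs \<omega>\<bar> \<le> M" if "\<omega> \<in> F - E" for \<omega>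
    using Cons.prems(3)[of \<omega>] that x by (simp add: simple_fun_def algebra_simps)
  obtain A1 B1 where 3: "A1 \<in> \<A>" "B1 \<in> \<A>" "A1 \<subseteq> F \<inter> E" "B1 \<subseteq> F \<inter> E"
    "\<bar>(d + c) * \<mu> (F \<inter> E) + simple_int (\<lambda>G. \<mu> (G \<inter> (F \<inter> E))) xs\<bar> \<le> M * (\<mu> A1 - \<mu> B1)"
    using Cons.IH[OF xs inter_in[OF F E] 1] by blast
  obtain A2 B2 where 4: "A2 \<in> \<A>" "B2 \<in> \<A>" "A2 \<subseteq> F - E" "B2 \<subseteq> F - E"
    "\<bar>d * \<mu> (F - E) + simple_int (\<lambda>G. \<mu> (G \<inter> (F - E))) xs\<bar> \<le> M * (\<mu> A2 - \<mu> B2)"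
    using Cons.IH[OF xs diff_in[OF F E] 2] by blast
  have split: "simple_int (\<lambda>G. \<mu> (G \<inter> F)) ys =
      simple_int (\<lambda>G. \<mu> (G \<inter> (F \<inter> E))) ys + simple_int (\<lambda>G. \<mu> (G \<inter> (F - E))) ys"
    if "set (map snd ys) \<subseteq> \<A>" for ys
    using that
  proof (induction ys)
    case (Cons y ys)
    obtain e G where y: "y = (e, G)" by force
    have "\<mu> (G \<inter> F) = \<mu> (G \<inter> (F \<inter> E)) + \<mu> (G \<inter> (F - E))"
      using fin_additive_split[OF \<mu> E inter_in[of G F]] F Cons.prems y
      by (simp add: Int_assoc Int_Diff)
    then show ?case using Cons y by (simp add: simple_int_def algebra_simps)
  qed (simp add: simple_int_def)
  have "d * \<mu> F + simple_int (\<lambda>G. \<mu> (G \<inter> F)) (x # xs)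
      = ((d + c) * \<mu> (F \<inter> E) + simple_int (\<lambda>G. \<mu> (G \<inter> (F \<inter> E))) xs)
        + (d * \<mu> (F - E) + simple_int (\<lambda>G. \<mu> (G \<inter> (F - E))) xs)"
    using split[OF xs] fin_additive_split[OF \<mu> E F] x
    by (simp add: simple_int_def algebra_simps Int_commute)
  moreover have "\<mu> (A1 \<union> A2) = \<mu> A1 + \<mu> A2" "\<mu> (B1 \<union> B2) = \<mu> B1 + \<mu> B2"
    using 3 4 by (auto intro!: fin_additiveD \<mu>)
  ultimately have "\<bar>d * \<mu> F + simple_int (\<lambda>G. \<mu> (G \<inter> F)) (x # xs)\<bar>
      \<le> M * (\<mu> (A1 \<union> A2) - \<mu> (B1 \<union> B2))"
    using 3(5) 4(5) by (simp add: algebra_simps)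
  then show ?case
    using 3 4 by (intro bexI[of _ "A1 \<union> A2"] bexI[of _ "B1 \<union> B2"] conjI union_in) auto
qed

text \<open>The variation estimate on the whole space with \<open>d = 0\<close>; the factor 2
  appears because \<mu> A and - \<mu> B are each at most \<open>K\<close>. This is the continuity of
  the integral in the sup norm, on which its extension from simple functions rests.\<close>

lemma simple_int_bound:
  assumes \<mu>: "fin_additive \<A> \<mu>" and K: "\<And>E. E \<in> \<A> \<Longrightarrow> \<bar>\<mu> E\<bar> \<le> K"
    and xs: "set (map snd xs) \<subseteq> \<A>" and "M \<ge> 0"
    and M: "\<And>\<omega>. \<omega> \<in> \<Omega> \<Longrightarrow> \<bar>simple_fun xs \<omega>\<bar> \<le> M"
  shows "\<bar>simple_int \<mu> xs\<bar> \<le> 2 * K * M"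
proof -
  obtain A B where AB: "A \<in> \<A>" "B \<in> \<A>"
      "\<bar>simple_int (\<lambda>E. \<mu> (E \<inter> \<Omega>)) xs\<bar> \<le> M * (\<mu> A - \<mu> B)"
    using simple_int_le_variation[OF \<mu> \<open>M \<ge> 0\<close> xs space_in, of 0] M by auto
  have "simple_int (\<lambda>E. \<mu> (E \<inter> \<Omega>)) xs = simple_int \<mu> xs"
    using xs sets_subset
    by (intro simple_int_cong arg_cong[of _ _ \<mu>]) blast
  moreover have "M * (\<mu> A - \<mu> B) \<le> M * (2 * K)"
    using K[OF AB(1)] K[OF AB(2)] \<open>M \<ge> 0\<close> by (intro mult_left_mono) auto
  ultimately show ?thesis using AB(3) by (simp add: mult_ac)
qed

section \<open>Uniform approximation by simple functions and the space \<open>Bfun\<close>\<close>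

definition approx :: "('w \<Rightarrow> real) \<Rightarrow> real \<Rightarrow> (real \<times> 'w set) list \<Rightarrow> bool" where
  "approx f \<delta> xs \<longleftrightarrow> set (map snd xs) \<subseteq> \<A> \<and> (\<forall>\<omega>\<in>\<Omega>. \<bar>f \<omega> - simple_fun xs \<omega>\<bar> \<le> \<delta>)"

lemma Bfun_approx: "f \<in> Bfun \<Omega> \<A> \<Longrightarrow> \<delta> > 0 \<Longrightarrow> \<exists>xs. approx f \<delta> xs"
  by (auto simp: Bfun_def approx_def)

lemma BfunI: "(\<And>\<delta>. \<delta> > 0 \<Longrightarrow> \<exists>xs. approx f \<delta> xs) \<Longrightarrow> f \<in> Bfun \<Omega> \<A>"
  by (auto simp: Bfun_def approx_def)

lemma approx_add:
  assumes "approx f \<delta> xs" "approx g \<epsilon> ys"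
  shows "approx (\<lambda>\<omega>. f \<omega> + g \<omega>) (\<delta> + \<epsilon>) (xs @ ys)"
  unfolding approx_def
proof (intro conjI ballI)
  fix \<omega> assume "\<omega> \<in> \<Omega>"
  then have "\<bar>f \<omega> - simple_fun xs \<omega>\<bar> \<le> \<delta>" "\<bar>g \<omega> - simple_fun ys \<omega>\<bar> \<le> \<epsilon>"
    using assms by (auto simp: approx_def)
  then show "\<bar>f \<omega> + g \<omega> - simple_fun (xs @ ys) \<omega>\<bar> \<le> \<delta> + \<epsilon>"
    unfolding simple_fun_append by linarith
qed (use assms in \<open>auto simp: approx_def\<close>)

lemma approx_scale:
  assumes "approx f \<delta> xs"
  shows "approx (\<lambda>\<omega>. a * f \<omega>) (\<bar>a\<bar> * \<delta>) (map (\<lambda>(c, E). (a * c, E)) xs)"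
  unfolding approx_def
proof (intro conjI ballI)
  fix \<omega> assume "\<omega> \<in> \<Omega>"
  then have "\<bar>a\<bar> * \<bar>f \<omega> - simple_fun xs \<omega>\<bar> \<le> \<bar>a\<bar> * \<delta>"
    using assms by (intro mult_left_mono) (auto simp: approx_def)
  then show "\<bar>a * f \<omega> - simple_fun (map (\<lambda>(c, E). (a * c, E)) xs) \<omega>\<bar> \<le> \<bar>a\<bar> * \<delta>"
    unfolding simple_fun_scale by (simp add: abs_mult[symmetric] right_diff_distrib)
qed (use assms in \<open>auto simp: approx_def\<close>)

lemma approx_const: "approx (\<lambda>_. c) 0 [(c, \<Omega>)]"
  by (auto simp: approx_def simple_fun_def space_in)

lemma approx_mono: "approx f \<delta> xs \<Longrightarrow> \<delta> \<le> \<epsilon> \<Longrightarrow> approx f \<epsilon> xs"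
  by (force simp: approx_def)

lemma Bfun_const: "(\<lambda>_. c) \<in> Bfun \<Omega> \<A>"
  using approx_mono[OF approx_const less_imp_le] by (intro BfunI exI)

lemma Bfun_add:
  assumes "f \<in> Bfun \<Omega> \<A>" "g \<in> Bfun \<Omega> \<A>"
  shows "(\<lambda>\<omega>. f \<omega> + g \<omega>) \<in> Bfun \<Omega> \<A>"
proof (rule BfunI)
  fix \<delta> :: real assume "\<delta> > 0"
  then obtain xs ys where "approx f (\<delta>/2) xs" "approx g (\<delta>/2) ys"
    using Bfun_approx assms by (meson half_gt_zero)
  from approx_add[OF this] show "\<exists>xs. approx (\<lambda>\<omega>. f \<omega> + g \<omega>) \<delta> xs" by auto
qed

lemma Bfun_scale:
  assumes "f \<in> Bfun \<Omega> \<A>"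
  shows "(\<lambda>\<omega>. a * f \<omega>) \<in> Bfun \<Omega> \<A>"
proof (rule BfunI)
  fix \<delta> :: real assume \<delta>: "\<delta> > 0"
  then obtain xs where "approx f (\<delta> / (\<bar>a\<bar> + 1)) xs"
    using Bfun_approx[OF assms, of "\<delta> / (\<bar>a\<bar> + 1)"] by (auto simp: add_nonneg_pos)
  from approx_scale[OF this, of a]
  show "\<exists>xs. approx (\<lambda>\<omega>. a * f \<omega>) \<delta> xs"
    using \<delta> by (intro exI) (erule approx_mono, simp add: field_simps)
qed

lemma Bfun_sum: "finite J \<Longrightarrow> (\<And>j. j \<in> J \<Longrightarrow> f j \<in> Bfun \<Omega> \<A>) \<Longrightarrow> (\<lambda>\<omega>. \<Sum>j\<in>J. f j \<omega>) \<in> Bfun \<Omega> \<A>"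
  by (induction J rule: finite_induct) (auto simp: Bfun_const Bfun_add)

section \<open>The integral of a uniform limit of simple functions\<close>

abbreviation FI :: "('w set \<Rightarrow> real) \<Rightarrow> ('w \<Rightarrow> real) \<Rightarrow> real" where
  "FI \<mu> f \<equiv> fa_integral \<Omega> \<A> \<mu> f"

lemma ba_fin_additive: "\<mu> \<in> ba \<Omega> \<A> \<Longrightarrow> fin_additive \<A> \<mu>"
  by (simp add: ba_def)

lemma ba_bound:
  assumes "\<mu> \<in> ba \<Omega> \<A>"
  obtains K where "K > 0" "\<And>E. E \<in> \<A> \<Longrightarrow> \<bar>\<mu> E\<bar> \<le> K"
proof -
  obtain K where "\<forall>E\<in>\<A>. \<bar>\<mu> E\<bar> \<le> K" using assms by (auto simp: ba_def)
  then show ?thesis by (intro that[of "max K 1"]) (auto simp: le_max_iff_disj)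
qed

text \<open>Appending the negated list \<open>ys\<close> to \<open>xs\<close> represents the
  difference, and as an approximation of f - f it is bounded by \<delta> + \<epsilon>. In
  particular, the integral does not depend on the list chosen to represent a simple
  function.\<close>

lemma simple_int_diff_bound:
  assumes \<mu>: "fin_additive \<A> \<mu>" and K: "\<And>E. E \<in> \<A> \<Longrightarrow> \<bar>\<mu> E\<bar> \<le> K"
    and xs: "approx f \<delta> xs" and ys: "approx f \<epsilon> ys" and "\<delta> \<ge> 0" "\<epsilon> \<ge> 0"
  shows "\<bar>simple_int \<mu> xs - simple_int \<mu> ys\<bar> \<le> 2 * K * (\<delta> + \<epsilon>)"
proof -
  let ?zs = "xs @ map (\<lambda>(c, E). (- 1 * c, E)) ys"
  have zs: "approx (\<lambda>\<omega>. f \<omega> + - 1 * f \<omega>) (\<delta> + \<bar>- 1\<bar> * \<epsilon>) ?zs"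
    by (intro approx_add approx_scale xs ys)
  have "\<bar>simple_int \<mu> ?zs\<bar> \<le> 2 * K * (\<delta> + \<epsilon>)"
    using zs \<open>\<delta> \<ge> 0\<close> \<open>\<epsilon> \<ge> 0\<close> by (intro simple_int_bound \<mu> K) (auto simp: approx_def)
  then show ?thesis unfolding simple_int_append simple_int_scale by simp
qed

text \<open>The number described by \<open>fa_integral\<close> exists and is unique: it is the limit
  of the integrals along any sequence of simple functions converging uniformly to \<open>f\<close>.
  The explicit error bound is what the linearity laws and the boundedness of the integral are
  derived from.\<close>

lemma fa_integral_approx:
  assumes \<mu>: "fin_additive \<A> \<mu>" and K: "\<And>E. E \<in> \<A> \<Longrightarrow> \<bar>\<mu> E\<bar> \<le> K"
    and f: "f \<in> Bfun \<Omega> \<A>" and xs: "approx f \<delta> xs" and "\<delta> \<ge> 0"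
  shows "\<bar>FI \<mu> f - simple_int \<mu> xs\<bar> \<le> 2 * K * \<delta>"
proof -
  have K0: "K \<ge> 0" using K[OF empty_in] by linarith
  obtain X where X: "\<And>n. approx f (inverse (real (Suc n))) (X n)"
  proof -
    have "\<forall>n. \<exists>xs. approx f (inverse (real (Suc n))) xs"
      by (intro allI Bfun_approx[OF f]) simp
    then show ?thesis using that by metis
  qed
  have b: "\<bar>simple_int \<mu> ys - simple_int \<mu> (X n)\<bar> \<le> 2 * K * (\<epsilon> + inverse (real (Suc n)))"
    if "approx f \<epsilon> ys" "\<epsilon> \<ge> 0" for ys \<epsilon> n
    using simple_int_diff_bound[OF \<mu> K that(1) X that(2)] by simp
  have lim0: "(\<lambda>n. inverse (real (Suc n))) \<longlonglongrightarrow> 0"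
    by (rule LIMSEQ_inverse_real_of_nat)
  have "Cauchy (\<lambda>n. simple_int \<mu> (X n))"
  proof (rule CauchyI)
    fix e :: real assume "e > 0"
    \<comment> \<open>The summand 1 in the denominator covers \<open>K = 0\<close>.\<close>
    then have "e / (4 * K + 1) > 0" using K0 by (intro divide_pos_pos) auto
    then obtain M where M: "\<And>n. n \<ge> M \<Longrightarrow> inverse (real (Suc n)) < e / (4 * K + 1)"
      using LIMSEQ_D[OF lim0] by (metis abs_of_nonneg diff_zero inverse_nonnegative_iff_nonnegative of_nat_0_le_iff real_norm_def)
    have "norm (simple_int \<mu> (X m) - simple_int \<mu> (X n)) < e" if "m \<ge> M" "n \<ge> M" for m n
    proof -
      have "\<bar>simple_int \<mu> (X m) - simple_int \<mu> (X n)\<bar>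
          \<le> 2 * K * (inverse (real (Suc m)) + inverse (real (Suc n)))"
        by (rule b[OF X]) simp
      also have "\<dots> \<le> 2 * K * (2 * (e / (4 * K + 1)))"
        using M[OF that(1)] M[OF that(2)] K0 by (intro mult_left_mono) auto
      also have "\<dots> < e" using \<open>e > 0\<close> K0 by (simp add: field_simps)
      finally show ?thesis by simp
    qed
    then show "\<exists>M. \<forall>m\<ge>M. \<forall>n\<ge>M. norm (simple_int \<mu> (X m) - simple_int \<mu> (X n)) < e" by blast
  qed
  then obtain r where r: "(\<lambda>n. simple_int \<mu> (X n)) \<longlonglongrightarrow> r"
    using Cauchy_convergent convergent_def by blast
  \<comment> \<open>Letting \<open>n\<close> tend to infinity in \<open>b\<close> removes the error
    of \<open>X n\<close> and leaves that of \<open>ys\<close>.\<close>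
  have br: "\<bar>r - simple_int \<mu> ys\<bar> \<le> 2 * K * \<epsilon>" if "approx f \<epsilon> ys" "\<epsilon> \<ge> 0" for ys \<epsilon>
  proof -
    have "(\<lambda>n. \<bar>simple_int \<mu> ys - simple_int \<mu> (X n)\<bar>) \<longlonglongrightarrow> \<bar>simple_int \<mu> ys - r\<bar>"
      by (intro tendsto_intros r)
    moreover have "(\<lambda>n. 2 * K * (\<epsilon> + inverse (real (Suc n)))) \<longlonglongrightarrow> 2 * K * (\<epsilon> + 0)"
      by (intro tendsto_intros lim0)
    ultimately have "\<bar>simple_int \<mu> ys - r\<bar> \<le> 2 * K * (\<epsilon> + 0)"
      by (rule LIMSEQ_le) (use b[OF that] in blast)
    then show ?thesis by (simp add: abs_minus_commute)
  qed
  have "FI \<mu> f = r"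
    unfolding fa_integral_def
  proof (rule the_equality)
    show "\<forall>\<epsilon>>0. \<exists>\<delta>>0. \<forall>xs. set (map snd xs) \<subseteq> \<A> \<and>
        (\<forall>\<omega>\<in>\<Omega>. \<bar>f \<omega> - simple_fun xs \<omega>\<bar> \<le> \<delta>) \<longrightarrow> \<bar>r - simple_int \<mu> xs\<bar> \<le> \<epsilon>"
    proof (intro allI impI)
      fix \<epsilon> :: real assume e: "\<epsilon> > 0"
      have p: "\<epsilon> / (2 * K + 1) > 0" using K0 e by (intro divide_pos_pos) auto
      have "2 * K * (\<epsilon> / (2 * K + 1)) \<le> \<epsilon>" using K0 e by (simp add: field_simps)
      then have "\<bar>r - simple_int \<mu> ys\<bar> \<le> \<epsilon>" if "approx f (\<epsilon> / (2 * K + 1)) ys" for ys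
        using br[OF that less_imp_le[OF p]] by linarith
      then show "\<exists>\<delta>>0. \<forall>xs. set (map snd xs) \<subseteq> \<A> \<and>
        (\<forall>\<omega>\<in>\<Omega>. \<bar>f \<omega> - simple_fun xs \<omega>\<bar> \<le> \<delta>) \<longrightarrow> \<bar>r - simple_int \<mu> xs\<bar> \<le> \<epsilon>"
        using p unfolding approx_def by blast
    qed
  next
    \<comment> \<open>Uniqueness: the \<open>X n\<close> are eventually fine enough for any
      \<delta>, so \<open>s\<close> is a limit of the same sequence as \<open>r\<close>.\<close>
    fix s assume s: "\<forall>\<epsilon>>0. \<exists>\<delta>>0. \<forall>xs. set (map snd xs) \<subseteq> \<A> \<and>
        (\<forall>\<omega>\<in>\<Omega>. \<bar>f \<omega> - simple_fun xs \<omega>\<bar> \<le> \<delta>) \<longrightarrow> \<bar>s - simple_int \<mu> xs\<bar> \<le> \<epsilon>"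
    have "(\<lambda>n. simple_int \<mu> (X n)) \<longlonglongrightarrow> s"
    proof (rule LIMSEQ_I)
      fix e :: real assume "e > 0"
      then obtain d where d: "d > 0" "\<And>xs. approx f d xs \<Longrightarrow> \<bar>s - simple_int \<mu> xs\<bar> \<le> e / 2"
        using s[rule_format, of "e/2"] unfolding approx_def by auto
      obtain M where M: "\<And>n. n \<ge> M \<Longrightarrow> inverse (real (Suc n)) < d"
        using LIMSEQ_D[OF lim0 d(1)] by (metis abs_of_nonneg diff_zero inverse_nonnegative_iff_nonnegative of_nat_0_le_iff real_norm_def)
      have "norm (simple_int \<mu> (X n) - s) < e" if "n \<ge> M" for n
        using d(2)[OF approx_mono[OF X less_imp_le[OF M[OF that]]]] \<open>e > 0\<close> by (simp add: abs_minus_commute)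
      then show "\<exists>M. \<forall>n\<ge>M. norm (simple_int \<mu> (X n) - s) < e" by blast
    qed
    then show "s = r" using r LIMSEQ_unique by blast
  qed
  then show ?thesis using br[OF xs \<open>\<delta> \<ge> 0\<close>] by simp
qed

lemma fa_integral_cong: "(\<And>\<omega>. \<omega> \<in> \<Omega> \<Longrightarrow> f \<omega> = g \<omega>) \<Longrightarrow> FI \<mu> f = FI \<mu> g"
  by (simp add: fa_integral_def cong: ball_cong)

lemma fa_integral_add:
  assumes \<mu>: "\<mu> \<in> ba \<Omega> \<A>" and f: "f \<in> Bfun \<Omega> \<A>" and g: "g \<in> Bfun \<Omega> \<A>"
  shows "FI \<mu> (\<lambda>\<omega>. f \<omega> + g \<omega>) = FI \<mu> f + FI \<mu> g"
proof -
  obtain K where K: "K > 0" "\<And>E. E \<in> \<A> \<Longrightarrow> \<bar>\<mu> E\<bar> \<le> K" using ba_bound[OF \<mu>] by blast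
  note ap = fa_integral_approx[OF ba_fin_additive[OF \<mu>] K(2)]
  show ?thesis
  proof (rule eq_by_approx[where C = "8 * K"])
    fix \<delta> :: real assume d: "\<delta> > 0"
    obtain xs ys where xs: "approx f \<delta> xs" and ys: "approx g \<delta> ys"
      using Bfun_approx f g d by meson
    have "\<bar>FI \<mu> f - simple_int \<mu> xs\<bar> \<le> 2 * K * \<delta>" using d by (intro ap f xs) auto
    moreover have "\<bar>FI \<mu> g - simple_int \<mu> ys\<bar> \<le> 2 * K * \<delta>" using d by (intro ap g ys) auto
    moreover have "\<bar>FI \<mu> (\<lambda>\<omega>. f \<omega> + g \<omega>) - simple_int \<mu> (xs @ ys)\<bar> \<le> 2 * K * (\<delta> + \<delta>)"
      using d by (intro ap Bfun_add f g approx_add xs ys) auto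
    ultimately show "\<bar>FI \<mu> (\<lambda>\<omega>. f \<omega> + g \<omega>) - (FI \<mu> f + FI \<mu> g)\<bar> \<le> 8 * K * \<delta>"
      unfolding simple_int_append by (simp add: distrib_left)
  qed
qed

lemma fa_integral_scale:
  assumes \<mu>: "\<mu> \<in> ba \<Omega> \<A>" and f: "f \<in> Bfun \<Omega> \<A>"
  shows "FI \<mu> (\<lambda>\<omega>. a * f \<omega>) = a * FI \<mu> f"
proof -
  obtain K where K: "K > 0" "\<And>E. E \<in> \<A> \<Longrightarrow> \<bar>\<mu> E\<bar> \<le> K" using ba_bound[OF \<mu>] by blast
  note ap = fa_integral_approx[OF ba_fin_additive[OF \<mu>] K(2)]
  show ?thesis
  proof (rule eq_by_approx[where C = "4 * \<bar>a\<bar> * K"])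
    fix \<delta> :: real assume d: "\<delta> > 0"
    obtain xs where xs: "approx f \<delta> xs"
      using Bfun_approx f d by meson
    let ?ys = "map (\<lambda>(c, E). (a * c, E)) xs"
    have "\<bar>FI \<mu> f - simple_int \<mu> xs\<bar> \<le> 2 * K * \<delta>" using d by (intro ap f xs) auto
    then have "\<bar>a\<bar> * \<bar>FI \<mu> f - simple_int \<mu> xs\<bar> \<le> \<bar>a\<bar> * (2 * K * \<delta>)"
      by (intro mult_left_mono) auto
    then have "\<bar>a * FI \<mu> f - a * simple_int \<mu> xs\<bar> \<le> \<bar>a\<bar> * (2 * K * \<delta>)"
      by (simp add: abs_mult[symmetric] right_diff_distrib)
    moreover have "\<bar>FI \<mu> (\<lambda>\<omega>. a * f \<omega>) - simple_int \<mu> ?ys\<bar> \<le> 2 * K * (\<bar>a\<bar> * \<delta>)"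
      using d by (intro ap Bfun_scale f approx_scale xs) auto
    ultimately show "\<bar>FI \<mu> (\<lambda>\<omega>. a * f \<omega>) - a * FI \<mu> f\<bar> \<le> 4 * \<bar>a\<bar> * K * \<delta>"
      unfolding simple_int_scale by (simp add: mult_ac)
  qed
qed

text \<open>A constant is approximated by a multiple of the indicator of \<Omega> with error 0, so
  the error estimate becomes an equality.\<close>

lemma fa_integral_const:
  assumes \<mu>: "\<mu> \<in> ba \<Omega> \<A>"
  shows "FI \<mu> (\<lambda>_. c) = c * \<mu> \<Omega>"
proof -
  obtain K where K: "\<And>E. E \<in> \<A> \<Longrightarrow> \<bar>\<mu> E\<bar> \<le> K" using ba_bound[OF \<mu>] by blast
  show ?thesis
    using fa_integral_approx[OF ba_fin_additive[OF \<mu>] K Bfun_const approx_const]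
    by (simp add: simple_int_def)
qed

lemma fa_integral_sum:
  assumes \<mu>: "\<mu> \<in> ba \<Omega> \<A>" and "finite J" "\<And>j. j \<in> J \<Longrightarrow> f j \<in> Bfun \<Omega> \<A>"
  shows "FI \<mu> (\<lambda>\<omega>. \<Sum>j\<in>J. f j \<omega>) = (\<Sum>j\<in>J. FI \<mu> (f j))"
  using assms(2,3)
  by (induction J rule: finite_induct)
    (simp_all add: fa_integral_const[OF \<mu>] fa_integral_add[OF \<mu>] Bfun_sum)

section \<open>The vector space \<open>ba\<close> and linearity of the integral in the
  measure\<close>

lemma ba_zero: "(\<lambda>_. 0) \<in> ba \<Omega> \<A>"
  by (auto simp: ba_def fin_additive_def)

lemma ba_add:
  assumes "\<mu> \<in> ba \<Omega> \<A>" "\<nu> \<in> ba \<Omega> \<A>"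
  shows "(\<lambda>E. \<mu> E + \<nu> E) \<in> ba \<Omega> \<A>"
proof -
  obtain K L where "\<And>E. E \<in> \<A> \<Longrightarrow> \<bar>\<mu> E\<bar> \<le> K" "\<And>E. E \<in> \<A> \<Longrightarrow> \<bar>\<nu> E\<bar> \<le> L"
    using ba_bound assms by metis
  then have "\<And>E. E \<in> \<A> \<Longrightarrow> \<bar>\<mu> E + \<nu> E\<bar> \<le> K + L"
    by (meson abs_triangle_ineq add_mono order_trans)
  then show ?thesis using assms by (auto simp: ba_def fin_additive_def)
qed

lemma ba_scale:
  assumes "\<mu> \<in> ba \<Omega> \<A>"
  shows "(\<lambda>E. a * \<mu> E) \<in> ba \<Omega> \<A>"
proof -
  obtain K where "\<And>E. E \<in> \<A> \<Longrightarrow> \<bar>\<mu> E\<bar> \<le> K" using ba_bound assms by metis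
  then have "\<And>E. E \<in> \<A> \<Longrightarrow> \<bar>a * \<mu> E\<bar> \<le> \<bar>a\<bar> * K"
    by (simp add: abs_mult mult_left_mono)
  then show ?thesis using assms by (auto simp: ba_def fin_additive_def distrib_left)
qed

lemma fa_integral_measure_add:
  assumes \<mu>: "\<mu> \<in> ba \<Omega> \<A>" and \<nu>: "\<nu> \<in> ba \<Omega> \<A>" and f: "f \<in> Bfun \<Omega> \<A>"
  shows "FI (\<lambda>E. \<mu> E + \<nu> E) f = FI \<mu> f + FI \<nu> f"
proof -
  obtain K where K: "\<And>E. E \<in> \<A> \<Longrightarrow> \<bar>\<mu> E\<bar> \<le> K" using ba_bound[OF \<mu>] by metis
  obtain L where L: "\<And>E. E \<in> \<A> \<Longrightarrow> \<bar>\<nu> E\<bar> \<le> L" using ba_bound[OF \<nu>] by metis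
  obtain H where H: "\<And>E. E \<in> \<A> \<Longrightarrow> \<bar>\<mu> E + \<nu> E\<bar> \<le> H"
    using ba_bound[OF ba_add[OF \<mu> \<nu>]] by metis
  show ?thesis
  proof (rule eq_by_approx[where C = "2 * (K + L + H)"])
    fix \<delta> :: real assume d: "\<delta> > 0"
    then obtain xs where xs: "approx f \<delta> xs" using Bfun_approx f by meson
    note ap = fa_integral_approx[OF _ _ f xs less_imp_le[OF d]]
    show "\<bar>FI (\<lambda>E. \<mu> E + \<nu> E) f - (FI \<mu> f + FI \<nu> f)\<bar> \<le> 2 * (K + L + H) * \<delta>"
      using ap[OF ba_fin_additive[OF \<mu>] K] ap[OF ba_fin_additive[OF \<nu>] L]
        ap[OF ba_fin_additive[OF ba_add[OF \<mu> \<nu>]] H]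
      unfolding simple_int_measure_add by (simp add: algebra_simps)
  qed
qed

lemma fa_integral_measure_scale:
  assumes \<mu>: "\<mu> \<in> ba \<Omega> \<A>" and f: "f \<in> Bfun \<Omega> \<A>"
  shows "FI (\<lambda>E. a * \<mu> E) f = a * FI \<mu> f"
proof -
  obtain K where K: "\<And>E. E \<in> \<A> \<Longrightarrow> \<bar>\<mu> E\<bar> \<le> K" using ba_bound[OF \<mu>] by metis
  obtain H where H: "\<And>E. E \<in> \<A> \<Longrightarrow> \<bar>a * \<mu> E\<bar> \<le> H"
    using ba_bound[OF ba_scale[OF \<mu>]] by metis
  show ?thesis
  proof (rule eq_by_approx[where C = "2 * (\<bar>a\<bar> * K + H)"])
    fix \<delta> :: real assume d: "\<delta> > 0"
    then obtain xs where xs: "approx f \<delta> xs" using Bfun_approx f by meson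
    note ap = fa_integral_approx[OF _ _ f xs less_imp_le[OF d]]
    have "\<bar>a\<bar> * \<bar>FI \<mu> f - simple_int \<mu> xs\<bar> \<le> \<bar>a\<bar> * (2 * K * \<delta>)"
      by (intro mult_left_mono ap[OF ba_fin_additive[OF \<mu>] K]) auto
    then have "\<bar>a * FI \<mu> f - a * simple_int \<mu> xs\<bar> \<le> \<bar>a\<bar> * (2 * K * \<delta>)"
      by (simp add: abs_mult[symmetric] right_diff_distrib)
    then show "\<bar>FI (\<lambda>E. a * \<mu> E) f - a * FI \<mu> f\<bar> \<le> 2 * (\<bar>a\<bar> * K + H) * \<delta>"
      using ap[OF ba_fin_additive[OF ba_scale[OF \<mu>, of a]] H]
      unfolding simple_int_measure_scale by (simp add: algebra_simps)
  qed
qed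

lemma ba_sum:
  "(\<And>k. k < n \<Longrightarrow> \<mu> k \<in> ba \<Omega> \<A>) \<Longrightarrow> (\<lambda>E. \<Sum>k<n. c k * \<mu> k E) \<in> ba \<Omega> \<A>" for n :: nat
  by (induction n) (auto simp: ba_zero intro!: ba_add ba_scale)

lemma fa_integral_measure_sum:
  fixes n :: nat
  assumes "f \<in> Bfun \<Omega> \<A>"
  shows "(\<And>k. k < n \<Longrightarrow> \<mu> k \<in> ba \<Omega> \<A>) \<Longrightarrow>
    FI (\<lambda>E. \<Sum>k<n. c k * \<mu> k E) f = (\<Sum>k<n. c k * FI (\<mu> k) f)"
proof (induction n)
  case 0
  show ?case using fa_integral_measure_scale[OF ba_zero assms, of 0] by simp
next
  case (Suc n)
  then show ?case
    by (simp add: fa_integral_measure_add[OF ba_sum ba_scale] fa_integral_measure_scale assms)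
qed

end

subsection \<open>Convex cones\<close>

text \<open>Projection onto the closure of a convex set in \<open>\<real>\<^sup>K\<close>. As \<open>K\<close> is a set and not a type, the
  Euclidean space theory does not apply; the limit \<open>a\<close> of a minimizing sequence, which is
  Cauchy by the parallelogram law, serves as the projection.\<close>

lemma convex_separation:
  fixes g :: "'k \<Rightarrow> 'x \<Rightarrow> real"
  assumes K: "finite K" and X: "X \<noteq> {}" and "\<epsilon> > 0"
    and far: "\<And>x. x \<in> X \<Longrightarrow> \<epsilon> \<le> (\<Sum>k\<in>K. (g k x)\<^sup>2)"
    and conv: "\<And>x y s. x \<in> X \<Longrightarrow> y \<in> X \<Longrightarrow> 0 \<le> s \<Longrightarrow> s \<le> 1 \<Longrightarrow>
      \<exists>z\<in>X. \<forall>k\<in>K. g k z = (1 - s) * g k x + s * g k y"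
  shows "\<exists>a. \<forall>x\<in>X. \<epsilon> \<le> (\<Sum>k\<in>K. a k * g k x)"
proof -
  \<comment> \<open>\<open>D\<close> is the squared Euclidean norm of the vector with coordinates
    \<open>g k x\<close>, and \<open>d\<close> is the squared distance of the image of
    \<open>X\<close> from the origin.\<close>
  define D where "D x = (\<Sum>k\<in>K. (g k x)\<^sup>2)" for x
  define d where "d = Inf (D ` X)"
  have bdd: "bdd_below (D ` X)" using far by (auto simp: D_def bdd_below_def)
  have d_le: "d \<le> D x" if "x \<in> X" for x
    unfolding d_def using bdd that by (intro cInf_lower) auto
  have "\<epsilon> \<le> d" unfolding d_def using X far by (intro cInf_greatest) (auto simp: D_def)
  have "\<forall>n. \<exists>x\<in>X. D x < d + inverse (real (Suc n))"
  proof
    fix n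
    have "Inf (D ` X) < d + inverse (real (Suc n))" by (simp add: d_def)
    then show "\<exists>x\<in>X. D x < d + inverse (real (Suc n))"
      using cInf_lessD[of "D ` X"] X by blast
  qed
  then obtain x where x: "\<And>n. x n \<in> X" "\<And>n. D (x n) < d + inverse (real (Suc n))"
    by metis
  have lim0: "(\<lambda>n. inverse (real (Suc n))) \<longlonglongrightarrow> 0"
    by (rule LIMSEQ_inverse_real_of_nat)
  have parallelogram: "(\<Sum>k\<in>K. (g k (x m) - g k (x n))\<^sup>2)
      \<le> 2 * inverse (real (Suc m)) + 2 * inverse (real (Suc n))" for m n
  proof -
    \<comment> \<open>The midpoint \<open>z\<close> also satisfies \<open>D z \<ge> d\<close>, so
      the two nearly minimal vectors must be close to each other.\<close>
    obtain z where z: "z \<in> X" "\<And>k. k \<in> K \<Longrightarrow> g k z = (1 - 1/2) * g k (x m) + 1/2 * g k (x n)"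
      using conv[OF x(1) x(1), of "1/2" m n] by auto
    have "(\<Sum>k\<in>K. (g k (x m) - g k (x n))\<^sup>2) = 2 * D (x m) + 2 * D (x n) - 4 * D z"
      unfolding D_def sum_distrib_left sum.distrib[symmetric] sum_subtractf[symmetric]
      by (intro sum.cong) (simp_all add: z(2) power2_eq_square field_simps)
    then show ?thesis using x(2)[of m] x(2)[of n] d_le[OF z(1)] by linarith
  qed
  have "Cauchy (\<lambda>n. g k (x n))" if k: "k \<in> K" for k
  proof (rule CauchyI)
    fix e :: real assume e: "e > 0"
    then have "e\<^sup>2 / 4 > 0" by simp
    then obtain M where M: "\<And>n. n \<ge> M \<Longrightarrow> inverse (real (Suc n)) < e\<^sup>2 / 4"
      using LIMSEQ_D[OF lim0]
      by (metis abs_of_nonneg diff_zero inverse_nonnegative_iff_nonnegative of_nat_0_le_iff real_norm_def)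
    have "norm (g k (x m) - g k (x n)) < e" if "m \<ge> M" "n \<ge> M" for m n
    proof -
      have "(g k (x m) - g k (x n))\<^sup>2 \<le> (\<Sum>k\<in>K. (g k (x m) - g k (x n))\<^sup>2)"
        using K k by (intro member_le_sum) auto
      also have "\<dots> < e\<^sup>2"
        using parallelogram[of m n] M[OF that(1)] M[OF that(2)] by linarith
      finally show ?thesis using e power2_less_imp_less[of "\<bar>g k (x m) - g k (x n)\<bar>" e] by simp
    qed
    then show "\<exists>M. \<forall>m\<ge>M. \<forall>n\<ge>M. norm (g k (x m) - g k (x n)) < e" by blast
  qed
  then have "\<forall>k\<in>K. \<exists>l. (\<lambda>n. g k (x n)) \<longlonglongrightarrow> l"
    using Cauchy_convergent convergent_def by blast
  then obtain a where a: "\<And>k. k \<in> K \<Longrightarrow> (\<lambda>n. g k (x n)) \<longlonglongrightarrow> a k" by metis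
  have "(\<lambda>n. D (x n)) \<longlonglongrightarrow> (\<Sum>k\<in>K. (a k)\<^sup>2)"
    unfolding D_def by (intro tendsto_intros a)
  moreover have "(\<lambda>n. D (x n)) \<longlonglongrightarrow> d"
  proof (rule tendsto_sandwich[of "\<lambda>_. d" _ _ "\<lambda>n. d + inverse (real (Suc n))"])
    show "(\<lambda>n. d + inverse (real (Suc n))) \<longlonglongrightarrow> d"
      using tendsto_add[OF tendsto_const lim0, of d] by simp
    show "\<forall>\<^sub>F n in sequentially. d \<le> D (x n)" using d_le x(1) by simp
    show "\<forall>\<^sub>F n in sequentially. D (x n) \<le> d + inverse (real (Suc n))"
      using x(2) less_imp_le by (intro always_eventually allI) blast
  qed auto
  ultimately have ad: "(\<Sum>k\<in>K. (a k)\<^sup>2) = d" by (rule LIMSEQ_unique)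
  have "\<epsilon> \<le> (\<Sum>k\<in>K. a k * g k y)" if y: "y \<in> X" for y
  proof -
    define P where "P = (\<Sum>k\<in>K. a k * (g k y - a k))"
    define Q where "Q = (\<Sum>k\<in>K. (g k y - a k)\<^sup>2)"
    \<comment> \<open>Moving from \<open>a\<close> towards \<open>y\<close> cannot bring the squared
      norm below \<open>d\<close>; expanding it and dividing by \<open>s\<close> gives the claim.
      The limit \<open>a\<close> need not come from a point of \<open>X\<close>, so the inequality
      is first obtained from the points \<open>x n\<close>.\<close>
    have quad: "0 \<le> 2 * P + s * Q" if s: "0 < s" "s \<le> 1" for s
    proof -
      have "d \<le> (\<Sum>k\<in>K. ((1 - s) * g k (x n) + s * g k y)\<^sup>2)" for n
      proof -
        obtain z where z: "z \<in> X" "\<And>k. k \<in> K \<Longrightarrow> g k z = (1 - s) * g k (x n) + s * g k y"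
          using conv[OF x(1) y, of s n] s by auto
        then show ?thesis using d_le[OF z(1)] by (simp add: D_def)
      qed
      moreover have "(\<lambda>n. \<Sum>k\<in>K. ((1 - s) * g k (x n) + s * g k y)\<^sup>2)
          \<longlonglongrightarrow> (\<Sum>k\<in>K. ((1 - s) * a k + s * g k y)\<^sup>2)"
        by (intro tendsto_intros a)
      ultimately have "d \<le> (\<Sum>k\<in>K. ((1 - s) * a k + s * g k y)\<^sup>2)"
        by (intro LIMSEQ_le_const) auto
      also have "\<dots> = (\<Sum>k\<in>K. (a k)\<^sup>2) + s * (2 * P + s * Q)"
        unfolding P_def Q_def sum_distrib_left sum.distrib[symmetric]
        by (intro sum.cong) (simp_all add: power2_eq_square algebra_simps)
      finally show ?thesis using ad s by (simp add: zero_le_mult_iff)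
    qed
    have "P \<ge> 0"
    proof (rule ccontr)
      assume "\<not> P \<ge> 0"
      have "Q \<ge> 0" by (simp add: Q_def sum_nonneg)
      \<comment> \<open>So small that \<open>s * Q \<le> - P\<close>, which makes
        \<open>2 * P + s * Q\<close> at most \<open>P\<close> and hence negative. The denominator
        \<open>Q + 1\<close> covers \<open>Q = 0\<close>, and the minimum with 1 keeps
        \<open>s\<close> in the range of \<open>quad\<close>.\<close>
      define s where "s = min 1 (- P / (Q + 1))"
      have "- P / (Q + 1) > 0" using \<open>\<not> P \<ge> 0\<close> \<open>Q \<ge> 0\<close> by (intro divide_pos_pos) auto
      then have "s > 0" by (simp add: s_def)
      have "s * Q \<le> (- P / (Q + 1)) * (Q + 1)"
        using \<open>Q \<ge> 0\<close> \<open>- P / (Q + 1) > 0\<close>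
        by (intro mult_mono less_imp_le[OF \<open>- P / (Q + 1) > 0\<close>]) (auto simp: s_def)
      also have "\<dots> = - P" using \<open>Q \<ge> 0\<close> by (intro nonzero_eq_divide_eq[THEN iffD1]) auto
      finally have "s * Q \<le> - P" .
      then show False using quad[of s] \<open>s > 0\<close> \<open>\<not> P \<ge> 0\<close> by (auto simp: s_def)
    qed
    \<comment> \<open>The inner product of \<open>a\<close> with the vector of \<open>y\<close> is
      therefore \<open>P + d\<close>, which is at least \<open>d\<close> and so at least
      \<epsilon>.\<close>
    moreover have "P = (\<Sum>k\<in>K. a k * g k y) - d"
      unfolding P_def ad[symmetric] sum_subtractf[symmetric]
      by (intro sum.cong) (simp_all add: power2_eq_square algebra_simps)
    ultimately show ?thesis using \<open>\<epsilon> \<le> d\<close> by simp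
  qed
  then show ?thesis by blast
qed

section \<open>Convex hulls and the cones over them\<close>

lemma ba_conv_superset: "\<mu> \<in> S \<Longrightarrow> \<mu> \<in> ba_conv S"
  unfolding ba_conv_def
  by (auto intro!: exI[of _ 1] exI[of _ "\<lambda>_. 1"] exI[of _ "\<lambda>_. \<mu>"])

lemma sum_lessThan_add:
  fixes f :: "nat \<Rightarrow> real"
  shows "(\<Sum>k<n + m. f k) = (\<Sum>k<n. f k) + (\<Sum>k<m. f (n + k))"
  by (induction m) auto

text \<open>The two convex combinations are concatenated, with the weights of the first multiplied
  by 1 - s and those of the second by s.\<close>

lemma ba_conv_convex:
  assumes "\<mu> \<in> ba_conv S" "\<nu> \<in> ba_conv S" "0 \<le> s" "s \<le> 1"
  shows "(\<lambda>E. (1 - s) * \<mu> E + s * \<nu> E) \<in> ba_conv S"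
proof -
  obtain n :: nat and c x where 1: "\<mu> = (\<lambda>E. \<Sum>k<n. c k * x k E)" "\<And>k. k < n \<Longrightarrow> c k \<ge> 0 \<and> x k \<in> S"
    "(\<Sum>k<n. c k) = 1" using assms(1) unfolding ba_conv_def by auto
  obtain m :: nat and b y where 2: "\<nu> = (\<lambda>E. \<Sum>k<m. b k * y k E)" "\<And>k. k < m \<Longrightarrow> b k \<ge> 0 \<and> y k \<in> S"
    "(\<Sum>k<m. b k) = 1" using assms(2) unfolding ba_conv_def by auto
  define e where "e k = (if k < n then (1 - s) * c k else s * b (k - n))" for k
  define z where "z k = (if k < n then x k else y (k - n))" for k
  have "(\<lambda>E. (1 - s) * \<mu> E + s * \<nu> E) = (\<lambda>E. \<Sum>k<n + m. e k * z k E)"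
    unfolding sum_lessThan_add 1 2 sum_distrib_left by (simp add: e_def z_def mult_ac)
  moreover have "\<forall>k<n + m. e k \<ge> 0 \<and> z k \<in> S"
    using 1(2) 2(2) assms(3,4) by (auto simp: e_def z_def)
  moreover have "(\<Sum>k<n + m. e k) = 1"
    unfolding sum_lessThan_add using 1(3) 2(3) by (simp add: e_def sum_distrib_left[symmetric])
  ultimately show ?thesis unfolding ba_conv_def by blast
qed

text \<open>Closure of a cone under addition, by normalizing the weights with their sum. If both
  weights vanish, any element of the hull will do.\<close>

lemma ba_conv_cone_add:
  assumes "\<mu> \<in> ba_conv S" "\<nu> \<in> ba_conv S" "0 \<le> b" "0 \<le> c"
  shows "\<exists>\<pi>\<in>ba_conv S. \<forall>E. (b + c) * \<pi> E = b * \<mu> E + c * \<nu> E"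
proof (cases "b + c = 0")
  case True
  then have "b = 0" "c = 0" using assms by auto
  then show ?thesis using assms by auto
next
  case False
  have "(\<lambda>E. (1 - c / (b + c)) * \<mu> E + c / (b + c) * \<nu> E) \<in> ba_conv S"
    using assms False by (intro ba_conv_convex) (auto simp: divide_simps)
  moreover have "(b + c) * ((1 - c / (b + c)) * \<mu> E + c / (b + c) * \<nu> E) = b * \<mu> E + c * \<nu> E" for E
  proof -
    have "1 - c / (b + c) = b / (b + c)" using False by (simp add: divide_simps)
    then show ?thesis using False by (simp add: distrib_left)
  qed
  ultimately show ?thesis
    by (intro bexI[of _ "\<lambda>E. (1 - c / (b + c)) * \<mu> E + c / (b + c) * \<nu> E"]) auto
qed

text \<open>Since the sets \<open>S j\<close> are nonempty, the adjoined zero tuple is itself a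
  multiple, by 0, of an element of the product. Sums are then taken coordinatewise; the new factor
  \<open>b + c\<close> is the same in every coordinate, as the cone over a product requires.\<close>

lemma cone_prod_add:
  assumes ne: "\<And>j. j \<in> J \<Longrightarrow> S j \<noteq> {}"
    and u: "u \<in> cone_prod J (\<lambda>j. ba_conv (S j))" and v: "v \<in> cone_prod J (\<lambda>j. ba_conv (S j))"
  shows "restrict (\<lambda>j E. u j E + v j E) J \<in> cone_prod J (\<lambda>j. ba_conv (S j))"
proof -
  have *: "\<exists>b x. w = restrict (\<lambda>j E. b * x j E) J \<and> b \<ge> 0 \<and> x \<in> PiE J (\<lambda>j. ba_conv (S j))"
    if "w \<in> cone_prod J (\<lambda>j. ba_conv (S j))" for w
  proof -
    have "\<forall>j\<in>J. \<exists>\<mu>. \<mu> \<in> ba_conv (S j)" using ne ba_conv_superset by (metis ex_in_conv)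
    then obtain x where "\<forall>j\<in>J. x j \<in> ba_conv (S j)" by metis
    then have "restrict (\<lambda>j E. 0) J = restrict (\<lambda>j E. 0 * restrict x J j E) J \<and> (0::real) \<ge> 0
        \<and> restrict x J \<in> PiE J (\<lambda>j. ba_conv (S j))" by auto
    then show ?thesis using that unfolding cone_prod_def by blast
  qed
  obtain b x where u': "u = restrict (\<lambda>j E. b * x j E) J" "b \<ge> 0" "x \<in> PiE J (\<lambda>j. ba_conv (S j))"
    using *[OF u] by blast
  obtain c y where v': "v = restrict (\<lambda>j E. c * y j E) J" "c \<ge> 0" "y \<in> PiE J (\<lambda>j. ba_conv (S j))"
    using *[OF v] by blast
  have "\<forall>j\<in>J. \<exists>\<pi>. \<pi> \<in> ba_conv (S j) \<and> (\<forall>E. (b + c) * \<pi> E = b * x j E + c * y j E)"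
    using ba_conv_cone_add[OF _ _ u'(2) v'(2)] u'(3) v'(3) by (fastforce simp: PiE_iff)
  then obtain z where z: "\<And>j. j \<in> J \<Longrightarrow> z j \<in> ba_conv (S j)"
    "\<And>j E. j \<in> J \<Longrightarrow> (b + c) * z j E = b * x j E + c * y j E" by metis
  have "restrict (\<lambda>j E. u j E + v j E) J = restrict (\<lambda>j E. (b + c) * restrict z J j E) J"
    using z(2) by (auto simp: u' v' restrict_def fun_eq_iff)
  moreover have "restrict z J \<in> PiE J (\<lambda>j. ba_conv (S j))" using z(1) by auto
  ultimately show ?thesis using u'(2) v'(2) unfolding cone_prod_def
    by (intro UnI1 CollectI exI[of _ "b + c"] exI[of _ "restrict z J"]) auto
qed

lemma cone_prod_scale:
  assumes "u \<in> cone_prod J P" "a \<ge> 0"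
  shows "restrict (\<lambda>j E. a * u j E) J \<in> cone_prod J P"
  using assms(1) unfolding cone_prod_def
proof (elim UnE CollectE exE conjE)
  fix b x assume "u = restrict (\<lambda>j E. b * x j E) J" "b \<ge> 0" "x \<in> PiE J P"
  then show "restrict (\<lambda>j E. a * u j E) J \<in>
    {restrict (\<lambda>j E. \<beta> * x j E) J |\<beta> x. 0 \<le> \<beta> \<and> x \<in> PiE J P} \<union> {restrict (\<lambda>j E. 0) J}"
    using assms(2)
    by (intro UnI1 CollectI exI[of _ "a * b"] exI[of _ x]) (auto simp: restrict_def fun_eq_iff)
qed (auto simp: restrict_def fun_eq_iff)

text \<open>The set \<open>S\<close> may be empty here, because it will consist of the types of one
  player that differ from a given type, and there may be none. The cone is then the zero tuple
  alone.\<close>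

lemma cone_diag_add:
  assumes u: "u \<in> cone_diag J (ba_conv S)" and v: "v \<in> cone_diag J (ba_conv S)"
  shows "restrict (\<lambda>j E. u j E + v j E) J \<in> cone_diag J (ba_conv S)"
proof (cases "S = {}")
  case True
  \<comment> \<open>The weights of an empty combination do not add up to 1.\<close>
  then have "ba_conv S = {}"
    unfolding ba_conv_def by (force simp: not_less)
  then show ?thesis using u v by (auto simp: cone_diag_def restrict_def fun_eq_iff)
next
  case False
  then obtain \<mu>0 where \<mu>0: "\<mu>0 \<in> ba_conv S" using ba_conv_superset by blast
  have *: "\<exists>b y. w = restrict (\<lambda>j E. b * y E) J \<and> b \<ge> 0 \<and> y \<in> ba_conv S"
    if "w \<in> cone_diag J (ba_conv S)" for w
  proof -
    have "restrict (\<lambda>j E. 0) J = restrict (\<lambda>j E. 0 * \<mu>0 E) J \<and> (0::real) \<ge> 0 \<and> \<mu>0 \<in> ba_conv S"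
      using \<mu>0 by auto
    then show ?thesis using that unfolding cone_diag_def by blast
  qed
  obtain b x where u': "u = restrict (\<lambda>j E. b * x E) J" "b \<ge> 0" "x \<in> ba_conv S"
    using *[OF u] by blast
  obtain c y where v': "v = restrict (\<lambda>j E. c * y E) J" "c \<ge> 0" "y \<in> ba_conv S"
    using *[OF v] by blast
  obtain z where z: "z \<in> ba_conv S" "\<And>E. (b + c) * z E = b * x E + c * y E"
    using ba_conv_cone_add[OF u'(3) v'(3) u'(2) v'(2)] by blast
  have "restrict (\<lambda>j E. u j E + v j E) J = restrict (\<lambda>j E. (b + c) * z E) J"
    using z(2) by (auto simp: u' v' restrict_def fun_eq_iff)
  then show ?thesis using u'(2) v'(2) z(1) unfolding cone_diag_def
    by (intro UnI1 CollectI exI[of _ "b + c"] exI[of _ z]) auto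
qed

lemma cone_diag_scale:
  assumes "u \<in> cone_diag J C" "a \<ge> 0"
  shows "restrict (\<lambda>j E. a * u j E) J \<in> cone_diag J C"
  using assms(1) unfolding cone_diag_def
proof (elim UnE CollectE exE conjE)
  fix b y assume "u = restrict (\<lambda>j E. b * y E) J" "b \<ge> 0" "y \<in> C"
  then show "restrict (\<lambda>j E. a * u j E) J \<in>
    {restrict (\<lambda>j E. \<beta> * y E) J |\<beta> y. 0 \<le> \<beta> \<and> y \<in> C} \<union> {restrict (\<lambda>j E. 0) J}"
    using assms(2)
    by (intro UnI1 CollectI exI[of _ "a * b"] exI[of _ y]) (auto simp: restrict_def fun_eq_iff)
qed (auto simp: restrict_def fun_eq_iff)

section \<open>The difference of the product cone and the diagonal cone is a convex cone\<close>

context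
  fixes J :: "'i set" and S :: "'i \<Rightarrow> ('w set \<Rightarrow> real) set" and R :: "('w set \<Rightarrow> real) set" and X
  assumes ne: "\<And>j. j \<in> J \<Longrightarrow> S j \<noteq> {}"
  defines "X \<equiv> tuple_minus J (cone_prod J (\<lambda>j. ba_conv (S j))) (cone_diag J (ba_conv R))"
begin

lemma tuple_minus_add:
  assumes "x \<in> X" "y \<in> X"
  shows "restrict (\<lambda>j E. x j E + y j E) J \<in> X"
proof -
  obtain u v where 1: "x = restrict (\<lambda>j E. u j E - v j E) J"
    "u \<in> cone_prod J (\<lambda>j. ba_conv (S j))" "v \<in> cone_diag J (ba_conv R)"
    using assms(1) unfolding X_def tuple_minus_def by blast
  obtain u' v' where 2: "y = restrict (\<lambda>j E. u' j E - v' j E) J"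
    "u' \<in> cone_prod J (\<lambda>j. ba_conv (S j))" "v' \<in> cone_diag J (ba_conv R)"
    using assms(2) unfolding X_def tuple_minus_def by blast
  have "restrict (\<lambda>j E. x j E + y j E) J
      = restrict (\<lambda>j E. restrict (\<lambda>j E. u j E + u' j E) J j E - restrict (\<lambda>j E. v j E + v' j E) J j E) J"
    by (auto simp: 1 2 restrict_def fun_eq_iff)
  then show ?thesis
    using cone_prod_add[OF ne 1(2) 2(2)] cone_diag_add[OF 1(3) 2(3)]
    unfolding X_def tuple_minus_def by blast
qed

lemma tuple_minus_scale:
  assumes "x \<in> X" "a \<ge> 0"
  shows "restrict (\<lambda>j E. a * x j E) J \<in> X"
proof -
  obtain u v where 1: "x = restrict (\<lambda>j E. u j E - v j E) J"
    "u \<in> cone_prod J (\<lambda>j. ba_conv (S j))" "v \<in> cone_diag J (ba_conv R)"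
    using assms(1) unfolding X_def tuple_minus_def by blast
  have "restrict (\<lambda>j E. a * x j E) J
      = restrict (\<lambda>j E. restrict (\<lambda>j E. a * u j E) J j E - restrict (\<lambda>j E. a * v j E) J j E) J"
    by (auto simp: 1 restrict_def fun_eq_iff right_diff_distrib)
  then show ?thesis
    using cone_prod_scale[OF 1(2) assms(2)] cone_diag_scale[OF 1(3) assms(2)]
    unfolding X_def tuple_minus_def by blast
qed

text \<open>Weight 1 in the first cone and the zero tuple from the second. Evaluated here, a
  functional that is nonnegative on \<open>X\<close> gives an inequality for every choice of one
  type per player.\<close>

lemma tuple_minus_prod:
  assumes "\<And>j. j \<in> J \<Longrightarrow> x j \<in> ba_conv (S j)"
  shows "restrict x J \<in> X"
  unfolding X_def tuple_minus_def
proof (intro CollectI exI conjI)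
  show "restrict (\<lambda>j E. 1 * restrict x J j E) J \<in> cone_prod J (\<lambda>j. ba_conv (S j))"
    unfolding cone_prod_def using assms
    by (intro UnI1 CollectI exI[of _ 1] exI[of _ "restrict x J"]) auto
  show "restrict (\<lambda>j E. 0) J \<in> cone_diag J (ba_conv R)" by (auto simp: cone_diag_def)
qed (auto simp: restrict_def fun_eq_iff)

text \<open>Zero tuple from the first cone and weight 1 in the second. Evaluated here, a functional
  that is nonnegative on \<open>X\<close> gives an upper bound 0 on the diagonal over
  \<open>R\<close>.\<close>

lemma tuple_minus_diag:
  assumes "y \<in> ba_conv R"
  shows "restrict (\<lambda>_ E. - y E) J \<in> X"
  unfolding X_def tuple_minus_def
proof (intro CollectI exI conjI)
  show "restrict (\<lambda>j E. 1 * y E) J \<in> cone_diag J (ba_conv R)"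
    unfolding cone_diag_def using assms
    by (intro UnI1 CollectI exI[of _ 1] exI[of _ y]) auto
  show "restrict (\<lambda>j E. 0) J \<in> cone_prod J (\<lambda>j. ba_conv (S j))" by (auto simp: cone_prod_def)
qed (auto simp: restrict_def fun_eq_iff)

end

lemma tuple_minus_cone_mono:
  assumes "\<And>j. j \<in> J \<Longrightarrow> P j \<subseteq> P' j" "C \<subseteq> C'"
  shows "tuple_minus J (cone_prod J P) (cone_diag J C) \<subseteq> tuple_minus J (cone_prod J P') (cone_diag J C')"
proof -
  have "cone_prod J P \<subseteq> cone_prod J P'"
    using PiE_mono[of J P P'] assms(1) unfolding cone_prod_def by blast
  moreover have "cone_diag J C \<subseteq> cone_diag J C'"
    using assms(2) unfolding cone_diag_def by blast
  ultimately show ?thesis unfolding tuple_minus_def by blast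
qed

subsection \<open>The weak* topology\<close>

lemma closure_of_nonneg:
  assumes "continuous_map X euclideanreal h" "\<And>x. x \<in> S \<Longrightarrow> h x \<ge> 0" "x \<in> X closure_of S"
  shows "h x \<ge> 0"
proof -
  have "h x \<in> closure (h ` S)"
    using continuous_map_image_closure_subset[OF assms(1), of S] assms(3) by auto
  moreover have "closure (h ` S) \<subseteq> {0..}"
    using assms(2) by (intro closure_minimal) auto
  ultimately show ?thesis by auto
qed

context set_field
begin

text \<open>The underlying set is the union of the generating sets, and the one for the zero
  function and \<open>U = UNIV\<close> is already all of \<open>ba\<close>.\<close>

lemma topspace_weakstar: "topspace (weakstar \<Omega> \<A>) = ba \<Omega> \<A>"
proof -
  have "ba \<Omega> \<A> = {\<mu> \<in> ba \<Omega> \<A>. FI \<mu> (\<lambda>_. 0) \<in> UNIV}" by simp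
  then show ?thesis
    unfolding weakstar_def topology_generated_by_topspace using Bfun_const[of 0] by blast
qed

lemma continuous_map_fa_integral:
  assumes "f \<in> Bfun \<Omega> \<A>"
  shows "continuous_map (weakstar \<Omega> \<A>) euclideanreal (\<lambda>\<mu>. FI \<mu> f)"
  unfolding continuous_map topspace_weakstar
proof (intro conjI allI impI)
  fix U :: "real set" assume "openin euclideanreal U"
  then show "openin (weakstar \<Omega> \<A>) {\<mu> \<in> ba \<Omega> \<A>. FI \<mu> f \<in> U}"
    unfolding weakstar_def using assms by (intro topology_generated_by_Basis) auto
qed auto

text \<open>Induction over the generation of the open set. An intersection is handled by the union
  of the two finite sets of functions and the smaller radius.\<close>

lemma weakstar_neighbourhood:
  assumes "openin (weakstar \<Omega> \<A>) V" "\<mu> \<in> V"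
  shows "\<exists>F \<epsilon>. finite F \<and> F \<subseteq> Bfun \<Omega> \<A> \<and> \<epsilon> > 0 \<and>
    (\<forall>\<nu>\<in>ba \<Omega> \<A>. (\<forall>f\<in>F. \<bar>FI \<nu> f - FI \<mu> f\<bar> < \<epsilon>) \<longrightarrow> \<nu> \<in> V)"
  using openin_topology_generated_by[OF assms(1)[unfolded weakstar_def]] assms(2)
proof induction
  case (Int a b)
  from Int.prems have "\<mu> \<in> a" "\<mu> \<in> b" by auto
  from Int.IH(1)[OF this(1)] obtain F \<epsilon> where F: "finite F" "F \<subseteq> Bfun \<Omega> \<A>" "\<epsilon> > 0"
    "\<forall>\<nu>\<in>ba \<Omega> \<A>. (\<forall>f\<in>F. \<bar>FI \<nu> f - FI \<mu> f\<bar> < \<epsilon>) \<longrightarrow> \<nu> \<in> a"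
    by (elim exE conjE)
  from Int.IH(2)[OF \<open>\<mu> \<in> b\<close>] obtain G \<delta> where G: "finite G" "G \<subseteq> Bfun \<Omega> \<A>" "\<delta> > 0"
    "\<forall>\<nu>\<in>ba \<Omega> \<A>. (\<forall>f\<in>G. \<bar>FI \<nu> f - FI \<mu> f\<bar> < \<delta>) \<longrightarrow> \<nu> \<in> b"
    by (elim exE conjE)
  from F G show ?case by (intro exI[of _ "F \<union> G"] exI[of _ "min \<epsilon> \<delta>"]) auto
next
  case (UN \<K>)
  then obtain k where "k \<in> \<K>" "\<mu> \<in> k" by blast
  from UN.IH[OF this] \<open>k \<in> \<K>\<close> show ?case by blast
next
  case (Basis s)
  then obtain f U where s: "s = {\<mu> \<in> ba \<Omega> \<A>. FI \<mu> f \<in> U}" "f \<in> Bfun \<Omega> \<A>" "open U" by blast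
  then obtain e where "e > 0" "\<And>y. dist y (FI \<mu> f) < e \<Longrightarrow> y \<in> U"
    using Basis.prems open_dist by blast
  then show ?case
    using s by (intro exI[of _ "{f}"] exI[of _ e]) (auto simp: dist_real_def)
qed simp

text \<open>The index set is finite, so the finitely many functions of all coordinates form one
  finite set of pairs, with a common radius. This is the reduction to finite dimension.\<close>

lemma product_weakstar_neighbourhood:
  fixes J :: "'i set"
  assumes J: "finite J" and U: "openin (product_topology (\<lambda>_. weakstar \<Omega> \<A>) J) U" "z \<in> U"
  shows "\<exists>K \<epsilon>. finite K \<and> K \<subseteq> J \<times> Bfun \<Omega> \<A> \<and> \<epsilon> > 0 \<and>
    (\<forall>y\<in>J \<rightarrow>\<^sub>E ba \<Omega> \<A>. (\<forall>(j, f)\<in>K. \<bar>FI (y j) f - FI (z j) f\<bar> < \<epsilon>) \<longrightarrow> y \<in> U)"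
proof -
  obtain V where V: "\<And>j. j \<in> J \<Longrightarrow> openin (weakstar \<Omega> \<A>) (V j)" "z \<in> PiE J V" "PiE J V \<subseteq> U"
    using U unfolding openin_product_topology_alt by metis
  have "\<forall>j\<in>J. \<exists>F \<epsilon>. finite F \<and> F \<subseteq> Bfun \<Omega> \<A> \<and> \<epsilon> > 0 \<and>
      (\<forall>\<nu>\<in>ba \<Omega> \<A>. (\<forall>f\<in>F. \<bar>FI \<nu> f - FI (z j) f\<bar> < \<epsilon>) \<longrightarrow> \<nu> \<in> V j)"
    using weakstar_neighbourhood[OF V(1)] V(2) by (simp add: PiE_iff)
  then obtain F \<epsilon> where F: "\<And>j. j \<in> J \<Longrightarrow> finite (F j)" "\<And>j. j \<in> J \<Longrightarrow> F j \<subseteq> Bfun \<Omega> \<A>"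
      "\<And>j. j \<in> J \<Longrightarrow> \<epsilon> j > (0::real)"
      "\<And>j \<nu>. j \<in> J \<Longrightarrow> \<nu> \<in> ba \<Omega> \<A> \<Longrightarrow> (\<forall>f\<in>F j. \<bar>FI \<nu> f - FI (z j) f\<bar> < \<epsilon> j) \<Longrightarrow> \<nu> \<in> V j"
    by metis
  \<comment> \<open>The inserted 1 makes the minimum meaningful when \<open>J\<close> is empty,
    which happens for a single player.\<close>
  define \<delta> where "\<delta> = Min (insert 1 (\<epsilon> ` J))"
  have \<delta>: "\<delta> > 0" "\<And>j. j \<in> J \<Longrightarrow> \<delta> \<le> \<epsilon> j"
    using J F(3) by (auto simp: \<delta>_def)
  have "y \<in> U" if y: "y \<in> J \<rightarrow>\<^sub>E ba \<Omega> \<A>" "\<forall>(j, f)\<in>Sigma J F. \<bar>FI (y j) f - FI (z j) f\<bar> < \<delta>" for y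
  proof -
    have "y j \<in> V j" if "j \<in> J" for j
      using y \<delta>(2) that by (intro F(4)) (auto simp: PiE_iff intro: less_le_trans)
    then have "y \<in> PiE J V" using y(1) by (auto simp: PiE_iff)
    then show ?thesis using V(3) by blast
  qed
  then show ?thesis
    using J F(1,2) \<delta>(1) by (intro exI[of _ "Sigma J F"] exI[of _ \<delta>]) auto
qed

text \<open>Separation of a point from a convex cone in the product weak* topology. A basic
  neighbourhood of \<open>z\<close> missing \<open>X\<close> reduces it to
  \<open>convex_separation\<close> in finitely many coordinates; invariance of \<open>X\<close>
  under scaling then turns the gap into the sign conditions.\<close>

lemma cone_separation:
  fixes J :: "'i set"
  assumes J: "finite J" and X: "X \<noteq> {}" "X \<subseteq> J \<rightarrow>\<^sub>E ba \<Omega> \<A>"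
    and add: "\<And>x y. x \<in> X \<Longrightarrow> y \<in> X \<Longrightarrow> restrict (\<lambda>j E. x j E + y j E) J \<in> X"
    and scale: "\<And>x a. x \<in> X \<Longrightarrow> a \<ge> 0 \<Longrightarrow> restrict (\<lambda>j E. a * x j E) J \<in> X"
    and z: "z \<in> J \<rightarrow>\<^sub>E ba \<Omega> \<A>" "z \<notin> product_topology (\<lambda>_. weakstar \<Omega> \<A>) J closure_of X"
  shows "\<exists>h. (\<forall>j\<in>J. h j \<in> Bfun \<Omega> \<A>) \<and> (\<forall>x\<in>X. 0 \<le> (\<Sum>j\<in>J. FI (x j) (h j))) \<and>
    (\<Sum>j\<in>J. FI (z j) (h j)) < 0"
proof -
  have ba: "x j \<in> ba \<Omega> \<A>" if "x \<in> X" "j \<in> J" for x j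
    using X(2) that by (auto simp: PiE_iff subset_iff)
  obtain U where U: "openin (product_topology (\<lambda>_. weakstar \<Omega> \<A>) J) U" "z \<in> U" "U \<inter> X = {}"
    using z unfolding in_closure_of topspace_product_topology topspace_weakstar by blast
  obtain K \<epsilon> where K: "finite K" "K \<subseteq> J \<times> Bfun \<Omega> \<A>" and \<epsilon>: "\<epsilon> > 0"
    and KU: "\<And>y. y \<in> J \<rightarrow>\<^sub>E ba \<Omega> \<A> \<Longrightarrow> (\<forall>(j, f)\<in>K. \<bar>FI (y j) f - FI (z j) f\<bar> < \<epsilon>) \<Longrightarrow> y \<in> U"
    using product_weakstar_neighbourhood[OF J U(1,2)] by blast
  \<comment> \<open>Coordinates are taken relative to \<open>z\<close>, so that missing the
    neighbourhood means having a coordinate of modulus at least \<epsilon>.\<close>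
  define g where "g k x = FI (x (fst k)) (snd k) - FI (z (fst k)) (snd k)" for k x
  have "\<exists>a. \<forall>x\<in>X. \<epsilon>\<^sup>2 \<le> (\<Sum>k\<in>K. a k * g k x)"
  proof (rule convex_separation[OF K(1) X(1)])
    show "\<epsilon>\<^sup>2 > 0" using \<epsilon> by simp
  next
    fix x assume x: "x \<in> X"
    then have "x \<notin> U" using U(3) by blast
    then obtain k where k: "k \<in> K" "\<not> \<bar>g k x\<bar> < \<epsilon>"
      using KU[of x] X(2) x by (force simp: g_def)
    then have "\<epsilon>\<^sup>2 \<le> (g k x)\<^sup>2" using \<epsilon> by (simp add: abs_le_square_iff[symmetric])
    also have "\<dots> \<le> (\<Sum>k\<in>K. (g k x)\<^sup>2)" using K(1) k(1) by (intro member_le_sum) auto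
    finally show "\<epsilon>\<^sup>2 \<le> (\<Sum>k\<in>K. (g k x)\<^sup>2)" .
  next
    fix x y and s :: real assume xy: "x \<in> X" "y \<in> X" and s: "0 \<le> s" "s \<le> 1"
    define w where "w = restrict (\<lambda>j E. restrict (\<lambda>j E. (1 - s) * x j E) J j E + restrict (\<lambda>j E. s * y j E) J j E) J"
    have "w \<in> X" unfolding w_def using s by (intro add scale xy) auto
    moreover have "g k w = (1 - s) * g k x + s * g k y" if "k \<in> K" for k
    proof -
      have k: "fst k \<in> J" "snd k \<in> Bfun \<Omega> \<A>" using that K(2) by auto
      then have "FI (w (fst k)) (snd k) = (1 - s) * FI (x (fst k)) (snd k) + s * FI (y (fst k)) (snd k)"
        by (simp add: w_def fa_integral_measure_add fa_integral_measure_scale ba_scale ba xy)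
      then show ?thesis by (simp add: g_def algebra_simps)
    qed
    ultimately show "\<exists>w\<in>X. \<forall>k\<in>K. g k w = (1 - s) * g k x + s * g k y" by blast
  qed
  then obtain a where a: "\<And>x. x \<in> X \<Longrightarrow> \<epsilon>\<^sup>2 \<le> (\<Sum>k\<in>K. a k * g k x)" by blast
  \<comment> \<open>The coefficients belonging to the same coordinate \<open>j\<close> are collected
    into one function, since the integral is linear in the integrand.\<close>
  define h where "h j = (\<lambda>\<omega>. \<Sum>k\<in>{k\<in>K. fst k = j}. a k * snd k \<omega>)" for j
  define L where "L x = (\<Sum>j\<in>J. FI (x j) (h j))" for x
  have h: "h j \<in> Bfun \<Omega> \<A>" for j
    unfolding h_def using K by (intro Bfun_sum Bfun_scale) auto
  have L: "L x = (\<Sum>k\<in>K. a k * FI (x (fst k)) (snd k))" if "x \<in> J \<rightarrow>\<^sub>E ba \<Omega> \<A>" for x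
  proof -
    have "FI (x j) (h j) = (\<Sum>k\<in>{k\<in>K. fst k = j}. a k * FI (x (fst k)) (snd k))" if "j \<in> J" for j
    proof -
      have "x j \<in> ba \<Omega> \<A>" using \<open>x \<in> J \<rightarrow>\<^sub>E ba \<Omega> \<A>\<close> that by auto
      then have "FI (x j) (h j) = (\<Sum>k\<in>{k\<in>K. fst k = j}. FI (x j) (\<lambda>\<omega>. a k * snd k \<omega>))"
        unfolding h_def using K by (intro fa_integral_sum Bfun_scale) auto
      also have "\<dots> = (\<Sum>k\<in>{k\<in>K. fst k = j}. a k * FI (x (fst k)) (snd k))"
        using K \<open>x j \<in> ba \<Omega> \<A>\<close> by (intro sum.cong fa_integral_scale) (auto intro!: fa_integral_scale)
      finally show ?thesis .
    qed
    then have "L x = (\<Sum>j\<in>J. \<Sum>k\<in>{k\<in>K. fst k = j}. a k * FI (x (fst k)) (snd k))"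
      unfolding L_def by (intro sum.cong) auto
    also have "\<dots> = (\<Sum>k\<in>K. a k * FI (x (fst k)) (snd k))"
      using K by (intro sum.group J) auto
    finally show ?thesis .
  qed
  have sep: "L z + \<epsilon>\<^sup>2 \<le> L x" if "x \<in> X" for x
  proof -
    have "(\<Sum>k\<in>K. a k * g k x) = L x - L z"
      using L[of x] L[OF z(1)] that X(2)
      by (auto simp: g_def right_diff_distrib sum_subtractf)
    then show ?thesis using a[OF that] by simp
  qed
  have L_scale: "L (restrict (\<lambda>j E. b * x j E) J) = b * L x" if "x \<in> X" for b x
    unfolding L_def sum_distrib_left
    by (intro sum.cong) (simp_all add: fa_integral_measure_scale ba that h)
  have "0 \<le> L x" if x: "x \<in> X" for x
  proof (rule ccontr)
    assume neg: "\<not> 0 \<le> L x"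
    \<comment> \<open>Scaling \<open>x\<close> by \<open>b\<close> lowers its value to the negative
      of \<bar>L z\<bar>, which is at most \<open>L z\<close>; this contradicts the gap in
      \<open>sep\<close>.\<close>
    define b where "b = \<bar>L z\<bar> / (- L x)"
    have "b \<ge> 0" using neg unfolding b_def by (intro divide_nonneg_pos) auto
    have "b * L x = - \<bar>L z\<bar>" using neg by (simp add: b_def)
    then have "L z + \<epsilon>\<^sup>2 \<le> - \<bar>L z\<bar>"
      using sep[OF scale[OF x \<open>b \<ge> 0\<close>]] L_scale[OF x] by simp
    moreover have "\<epsilon>\<^sup>2 > 0" using \<epsilon> by simp
    ultimately show False by linarith
  qed
  moreover have "L z < 0"
  proof -
    \<comment> \<open>Scaling by 0 gives the zero tuple, where the functional vanishes, so the gap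
      forces \<open>L z\<close> below 0.\<close>
    obtain x where "x \<in> X" using X(1) by blast
    then show ?thesis using sep[OF scale[of x 0]] L_scale[of x 0] \<epsilon> 
      by (smt (verit, ccfv_threshold) mult_zero_left zero_less_power)
  qed
  ultimately show ?thesis using h unfolding L_def by blast
qed

lemma pba_on_field:
  assumes "on_field \<A> \<mu> \<in> pba \<Omega> \<A>"
  shows "on_field \<A> \<mu> \<in> ba \<Omega> \<A>" "E \<in> \<A> \<Longrightarrow> \<bar>on_field \<A> \<mu> E\<bar> \<le> 1"
proof -
  let ?\<nu> = "on_field \<A> \<mu>"
  have \<nu>: "fin_additive \<A> ?\<nu>" "\<And>E. E \<in> \<A> \<Longrightarrow> ?\<nu> E \<ge> 0" "?\<nu> \<Omega> = 1"
    using assms by (auto simp: pba_def)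
  show *: "\<bar>?\<nu> E\<bar> \<le> 1" if "E \<in> \<A>" for E
  proof -
    have "?\<nu> \<Omega> = ?\<nu> (\<Omega> \<inter> E) + ?\<nu> (\<Omega> - E)"
      by (rule fin_additive_split[OF \<nu>(1) that space_in])
    moreover have "\<Omega> \<inter> E = E" using sets_subset[OF that] by auto
    ultimately show ?thesis using \<nu>(2)[OF that] \<nu>(2)[OF compl_in[OF that]] \<nu>(3) by simp
  qed
  then show "?\<nu> \<in> ba \<Omega> \<A>" using \<nu>(1) unfolding ba_def by (auto simp: on_field_def)
qed

text \<open>One simple function within distance 1 of \<open>f\<close> serves all these measures: the
  constant 2 bounds the approximation error, and the coefficients bound the simple integral. It
  makes the infimum of expectations over all types of a player finite.\<close>

lemma fa_integral_bounded:
  assumes f: "f \<in> Bfun \<Omega> \<A>"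
  shows "\<exists>C. \<forall>\<mu>\<in>ba \<Omega> \<A>. (\<forall>E\<in>\<A>. \<bar>\<mu> E\<bar> \<le> 1) \<longrightarrow> \<bar>FI \<mu> f\<bar> \<le> C"
proof -
  obtain xs where xs: "approx f 1 xs" using Bfun_approx[OF f, of 1] by auto
  have "\<bar>FI \<mu> f\<bar> \<le> 2 + (\<Sum>(c, E)\<leftarrow>xs. \<bar>c\<bar>)" if "\<mu> \<in> ba \<Omega> \<A>" and 1: "\<forall>E\<in>\<A>. \<bar>\<mu> E\<bar> \<le> 1" for \<mu>
  proof -
    have "\<bar>FI \<mu> f - simple_int \<mu> xs\<bar> \<le> 2 * 1 * 1"
      using that xs by (intro fa_integral_approx ba_fin_additive f) auto
    moreover have "\<bar>simple_int \<mu> ys\<bar> \<le> (\<Sum>(c, E)\<leftarrow>ys. \<bar>c\<bar>)" if "set (map snd ys) \<subseteq> \<A>" for ys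
      using that
    proof (induction ys)
      case (Cons y ys)
      obtain c E where y: "y = (c, E)" by force
      have "\<bar>c * \<mu> E\<bar> \<le> \<bar>c\<bar>" using 1 Cons.prems y by (simp add: abs_mult mult_left_le)
      then show ?case using Cons y by (simp add: simple_int_def)
    qed (simp add: simple_int_def)
    ultimately show ?thesis using xs by (fastforce simp: approx_def)
  qed
  then show ?thesis by blast
qed

section \<open>Weak* closed convex hulls and cones inside \<open>ba\<close>\<close>

lemma ba_conv_subset: "S \<subseteq> ba \<Omega> \<A> \<Longrightarrow> ba_conv S \<subseteq> ba \<Omega> \<A>"
  unfolding ba_conv_def by (auto intro!: ba_sum)

lemma ba_conv_subset_closure:
  "S \<subseteq> ba \<Omega> \<A> \<Longrightarrow> ba_conv S \<subseteq> weakstar \<Omega> \<A> closure_of ba_conv S"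
  by (intro closure_of_subset) (simp add: topspace_weakstar ba_conv_subset)

lemma weakstar_closure_subset_ba: "weakstar \<Omega> \<A> closure_of S \<subseteq> ba \<Omega> \<A>"
  using closure_of_subset_topspace[of "weakstar \<Omega> \<A>"] by (simp add: topspace_weakstar)

text \<open>Nonnegativity passes to convex combinations by linearity in the measure, and to the
  closure by weak* continuity of integration.\<close>

lemma weakstar_closure_conv_fa_integral_nonneg:
  assumes S: "S \<subseteq> ba \<Omega> \<A>" and f: "f \<in> Bfun \<Omega> \<A>" and nn: "\<And>\<mu>. \<mu> \<in> S \<Longrightarrow> FI \<mu> f \<ge> 0"
    and \<mu>: "\<mu> \<in> weakstar \<Omega> \<A> closure_of ba_conv S"
  shows "FI \<mu> f \<ge> 0"
proof (rule closure_of_nonneg[OF continuous_map_fa_integral[OF f] _ \<mu>])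
  fix \<nu> assume "\<nu> \<in> ba_conv S"
  then obtain n :: nat and c x where \<nu>: "\<nu> = (\<lambda>E. \<Sum>k<n. c k * x k E)" "\<And>k. k < n \<Longrightarrow> c k \<ge> 0 \<and> x k \<in> S"
    unfolding ba_conv_def by auto
  then have "FI \<nu> f = (\<Sum>k<n. c k * FI (x k) f)"
    unfolding \<nu>(1) using S by (intro fa_integral_measure_sum f) auto
  also have "\<dots> \<ge> 0" using \<nu>(2) nn by (intro sum_nonneg mult_nonneg_nonneg) auto
  finally show "FI \<nu> f \<ge> 0" .
qed

lemma tuple_minus_cone_subset:
  assumes P: "\<And>j. j \<in> J \<Longrightarrow> P j \<subseteq> ba \<Omega> \<A>" and C: "C \<subseteq> ba \<Omega> \<A>"
  shows "tuple_minus J (cone_prod J P) (cone_diag J C) \<subseteq> J \<rightarrow>\<^sub>E ba \<Omega> \<A>"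
proof
  fix x assume "x \<in> tuple_minus J (cone_prod J P) (cone_diag J C)"
  then obtain u v where x: "x = restrict (\<lambda>j E. u j E - v j E) J"
    and u: "u \<in> cone_prod J P" and v: "v \<in> cone_diag J C"
    unfolding tuple_minus_def by blast
  have "u j \<in> ba \<Omega> \<A>" "v j \<in> ba \<Omega> \<A>" if "j \<in> J" for j
    using u v that P C unfolding cone_prod_def cone_diag_def
    by (auto simp: ba_zero PiE_iff subset_iff intro!: ba_scale)
  then have "(\<lambda>E. u j E + - 1 * v j E) \<in> ba \<Omega> \<A>" if "j \<in> J" for j
    using that by (intro ba_add ba_scale) auto
  then show "x \<in> J \<rightarrow>\<^sub>E ba \<Omega> \<A>" unfolding x by auto
qed

end

subsection \<open>Bets and strong consistency\<close>

lemma type_space_ttype: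
  assumes "type_space \<Omega> \<A> N \<M> t" "i \<in> N" "\<omega> \<in> \<Omega>"
  shows "ttype \<A> t i \<omega> \<in> ba \<Omega> \<A>" "E \<in> \<A> \<Longrightarrow> \<bar>ttype \<A> t i \<omega> E\<bar> \<le> 1" "ttype \<A> t i \<omega> \<Omega> = 1"
proof -
  interpret set_field \<Omega> \<A> using assms(1) by unfold_locales (simp add: type_space_def)
  have p: "on_field \<A> (t i \<omega>) \<in> pba \<Omega> \<A>" using assms by (auto simp: type_space_def)
  show "ttype \<A> t i \<omega> \<in> ba \<Omega> \<A>" "E \<in> \<A> \<Longrightarrow> \<bar>ttype \<A> t i \<omega> E\<bar> \<le> 1" "ttype \<A> t i \<omega> \<Omega> = 1"
    using pba_on_field[OF p] p by (auto simp: ttype_def pba_def)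
qed

lemma acceptable_bet_not_strongly_consistent:
  assumes T: "type_space \<Omega> \<A> N \<M> t" and bet: "acceptable_bet \<Omega> \<A> N t I f"
  shows "\<not> strongly_consistent \<Omega> \<A> N t"
proof
  assume sc: "strongly_consistent \<Omega> \<A> N t"
  interpret set_field \<Omega> \<A> using T by unfold_locales (simp add: type_space_def)
  have I: "finite I" "I \<subseteq> N" and f: "\<And>i. i \<in> I \<Longrightarrow> f i \<in> Bfun \<Omega> \<A>"
    and sum0: "\<And>\<omega>. \<omega> \<in> \<Omega> \<Longrightarrow> (\<Sum>i\<in>I. f i \<omega>) = 0"
    using bet by (auto simp: acceptable_bet_def is_bet_def)
  \<comment> \<open>A state belongs to every event that is commonly certain at it.\<close>
  have nn: "FI (ttype \<A> t i \<omega>) (f i) \<ge> 0" if "i \<in> I" "\<omega> \<in> \<Omega>" for i \<omega>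
    using bet that unfolding acceptable_bet_def commonly_certain_def by blast
  obtain \<omega>0 i0 where 0: "\<omega>0 \<in> \<Omega>" "i0 \<in> I" "FI (ttype \<A> t i0 \<omega>0) (f i0) > 0"
    using bet by (auto simp: acceptable_bet_def)
  define J where "J = I - {i0}"
  have J: "finite J" "\<And>j. j \<in> J \<Longrightarrow> j \<in> I" using I by (auto simp: J_def)
  have ty: "ttype \<A> t i ` A \<subseteq> ba \<Omega> \<A>" if "i \<in> I" "A \<subseteq> \<Omega>" for i A
    using type_space_ttype(1)[OF T] that I(2) by auto
  define L where "L x = (\<Sum>j\<in>J. FI (x j) (f j))" for x
  \<comment> \<open>On a constant tuple the zero sum of the bet leaves minus the expectation of
    player \<open>i0\<close>; this gives both the sign at the type of \<open>i0\<close> and the sign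
    on the diagonal cone.\<close>
  have diag: "(\<Sum>j\<in>J. FI \<mu> (f j)) = - FI \<mu> (f i0)" if \<mu>: "\<mu> \<in> ba \<Omega> \<A>" for \<mu>
  proof -
    have "(\<Sum>i\<in>I. FI \<mu> (f i)) = FI \<mu> (\<lambda>\<omega>. \<Sum>i\<in>I. f i \<omega>)"
      by (rule fa_integral_sum[symmetric, OF \<mu> I(1) f])
    also have "\<dots> = FI \<mu> (\<lambda>_. 0)" using sum0 by (rule fa_integral_cong)
    also have "\<dots> = 0" using fa_integral_const[OF \<mu>, of 0] by simp
    finally show ?thesis using sum.remove[OF I(1) 0(2), of "\<lambda>i. FI \<mu> (f i)"] by (simp add: J_def)
  qed
  let ?\<tau> = "ttype \<A> t i0 \<omega>0"
  have "L (restrict (\<lambda>_. ?\<tau>) J) \<ge> 0"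
  proof (rule closure_of_nonneg[where h = L])
    show "restrict (\<lambda>_. ?\<tau>) J \<in> product_topology (\<lambda>_. weakstar \<Omega> \<A>) J closure_of
      tuple_minus J (cone_prod J (PiT \<Omega> \<A> t)) (cone_diag J (PiT_minus \<Omega> \<A> t i0 \<omega>0))"
      using sc I 0 unfolding strongly_consistent_def J_def by blast
    show "continuous_map (product_topology (\<lambda>_. weakstar \<Omega> \<A>) J) euclideanreal L"
      unfolding L_def
    proof (intro continuous_map_sum J(1))
      fix j assume "j \<in> J"
      then show "continuous_map (product_topology (\<lambda>_. weakstar \<Omega> \<A>) J) euclideanreal (\<lambda>x. FI (x j) (f j))"
        using continuous_map_compose[OF continuous_map_product_projection[of j J "\<lambda>_. weakstar \<Omega> \<A>"]
            continuous_map_fa_integral[OF f[of j]]] J(2) by (simp add: o_def)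
    qed
  next
    fix x assume "x \<in> tuple_minus J (cone_prod J (PiT \<Omega> \<A> t)) (cone_diag J (PiT_minus \<Omega> \<A> t i0 \<omega>0))"
    then obtain u v where x: "x = restrict (\<lambda>j E. u j E - v j E) J"
      and u: "u \<in> cone_prod J (PiT \<Omega> \<A> t)" and v: "v \<in> cone_diag J (PiT_minus \<Omega> \<A> t i0 \<omega>0)"
      unfolding tuple_minus_def by blast
    have u': "u j \<in> ba \<Omega> \<A> \<and> FI (u j) (f j) \<ge> 0" if j: "j \<in> J" for j
    proof -
      have PiT_ba: "PiT \<Omega> \<A> t j \<subseteq> ba \<Omega> \<A>" unfolding PiT_def by (rule weakstar_closure_subset_ba)
      \<comment> \<open>The second case is the zero tuple that \<open>cone_prod\<close>
        adjoins.\<close>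
      consider b y where "b \<ge> 0" "y \<in> PiT \<Omega> \<A> t j" "u j = (\<lambda>E. b * y E)" | "u j = (\<lambda>E. 0 * 0)"
        using u j unfolding cone_prod_def by (auto simp: PiE_iff)
      then show ?thesis
      proof cases
        case 1
        have "FI y (f j) \<ge> 0"
          using weakstar_closure_conv_fa_integral_nonneg[OF ty[OF J(2)[OF j] order_refl] f[OF J(2)[OF j]]]
            nn[OF J(2)[OF j]] 1(2) unfolding PiT_def by blast
        then show ?thesis
          using 1 PiT_ba by (auto simp: fa_integral_measure_scale f J(2)[OF j] subset_iff intro!: ba_scale)
      next
        case 2
        then show ?thesis
          using fa_integral_measure_scale[OF ba_zero f[OF J(2)[OF j]], of 0] by (simp add: ba_zero)
      qed
    qed
    have "\<exists>w\<in>ba \<Omega> \<A>. (\<forall>j\<in>J. v j = w) \<and> FI w (f i0) \<ge> 0"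
    proof -
      have R: "{\<omega> \<in> \<Omega>. ttype \<A> t i0 \<omega> \<noteq> ttype \<A> t i0 \<omega>0} \<subseteq> \<Omega>" by auto
      have Pi_ba: "PiT_minus \<Omega> \<A> t i0 \<omega>0 \<subseteq> ba \<Omega> \<A>"
        unfolding PiT_minus_def by (rule weakstar_closure_subset_ba)
      consider b y where "b \<ge> 0" "y \<in> PiT_minus \<Omega> \<A> t i0 \<omega>0" "\<forall>j\<in>J. v j = (\<lambda>E. b * y E)"
        | "\<forall>j\<in>J. v j = (\<lambda>E. 0)"
        using v unfolding cone_diag_def by auto
      then show ?thesis
      proof cases
        case 1
        have "FI y (f i0) \<ge> 0"
          using weakstar_closure_conv_fa_integral_nonneg[OF ty[OF 0(2) R] f[OF 0(2)]] nn[OF 0(2)] 1(2)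
          unfolding PiT_minus_def by blast
        moreover have "y \<in> ba \<Omega> \<A>" using 1(2) Pi_ba by auto
        ultimately show ?thesis
          using 1 by (intro bexI[of _ "\<lambda>E. b * y E"])
            (auto simp: fa_integral_measure_scale f[OF 0(2)] intro!: ba_scale)
      next
        case 2
        then show ?thesis
          using fa_integral_measure_scale[OF ba_zero f[OF 0(2)], of 0]
          by (intro bexI[of _ "\<lambda>E. 0"]) (auto simp: ba_zero)
      qed
    qed
    then obtain w where w: "w \<in> ba \<Omega> \<A>" "\<And>j. j \<in> J \<Longrightarrow> v j = w" "FI w (f i0) \<ge> 0" by blast
    have "L x = (\<Sum>j\<in>J. FI (u j) (f j) - FI w (f j))"
      unfolding L_def
    proof (intro sum.cong refl)
      fix j assume j: "j \<in> J"
      have "FI (\<lambda>E. u j E + - 1 * w E) (f j) = FI (u j) (f j) + - 1 * FI w (f j)"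
        using u'[OF j] w(1) f[OF J(2)[OF j]]
        by (simp only: fa_integral_measure_add ba_scale fa_integral_measure_scale)
      then show "FI (x j) (f j) = FI (u j) (f j) - FI w (f j)"
        using j by (simp add: x w(2))
    qed
    \<comment> \<open>By \<open>diag\<close>, subtracting the diagonal term adds the expectation of
      \<open>f i0\<close> under \<open>w\<close>, which is nonnegative.\<close>
    also have "\<dots> = (\<Sum>j\<in>J. FI (u j) (f j)) + FI w (f i0)"
      using diag[OF w(1)] by (simp add: sum_subtractf)
    also have "\<dots> \<ge> 0" using u' w(3) by (intro add_nonneg_nonneg sum_nonneg) auto
    finally show "L x \<ge> 0" .
  qed
  moreover have "L (restrict (\<lambda>_. ?\<tau>) J) = (\<Sum>j\<in>J. FI ?\<tau> (f j))"
    unfolding L_def by (intro sum.cong) auto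
  ultimately show False
    using diag[of ?\<tau>] 0 type_space_ttype(1)[OF T] I(2) by (metis neg_0_le_iff_le not_less subsetD)
qed

lemma not_strongly_consistent_acceptable_bet:
  assumes T: "type_space \<Omega> \<A> N \<M> t" and nsc: "\<not> strongly_consistent \<Omega> \<A> N t"
  shows "\<exists>I f. acceptable_bet \<Omega> \<A> N t I f"
proof -
  interpret set_field \<Omega> \<A> using T by unfold_locales (simp add: type_space_def)
  obtain I i0 \<omega>0 where I: "finite I" "I \<subseteq> N" "i0 \<in> I" "\<omega>0 \<in> \<Omega>"
    and notin: "restrict (\<lambda>_. ttype \<A> t i0 \<omega>0) (I - {i0}) \<notin>
          product_topology (\<lambda>_. weakstar \<Omega> \<A>) (I - {i0}) closure_of
            tuple_minus (I - {i0}) (cone_prod (I - {i0}) (PiT \<Omega> \<A> t))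
                                   (cone_diag (I - {i0}) (PiT_minus \<Omega> \<A> t i0 \<omega>0))"
    using nsc unfolding strongly_consistent_def by blast
  define J where "J = I - {i0}"
  define \<tau> where "\<tau> = ttype \<A> t i0 \<omega>0"
  define S where "S i = ttype \<A> t i ` \<Omega>" for i
  define R where "R = ttype \<A> t i0 ` {\<omega> \<in> \<Omega>. ttype \<A> t i0 \<omega> \<noteq> \<tau>}"
  define X where "X = tuple_minus J (cone_prod J (\<lambda>j. ba_conv (S j))) (cone_diag J (ba_conv R))"
  have J: "finite J" "\<And>j. j \<in> J \<Longrightarrow> j \<in> I" "\<And>j. j \<in> J \<Longrightarrow> j \<noteq> i0" using I by (auto simp: J_def)
  have ty: "ttype \<A> t i \<omega> \<in> ba \<Omega> \<A>" if "i \<in> I" "\<omega> \<in> \<Omega>" for i \<omega>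
    using type_space_ttype(1)[OF T] that I(2) by auto
  have ty1: "ttype \<A> t i \<omega> \<Omega> = 1" if "i \<in> I" "\<omega> \<in> \<Omega>" for i \<omega>
    using type_space_ttype(3)[OF T] that I(2) by auto
  have S: "S i \<subseteq> ba \<Omega> \<A>" if "i \<in> I" for i using ty that by (auto simp: S_def)
  have R: "R \<subseteq> ba \<Omega> \<A>" using ty I(3) by (auto simp: R_def)
  have ne: "S j \<noteq> {}" for j using I(4) by (auto simp: S_def)
  \<comment> \<open>Each player may have a state \<open>w j\<close> of their own; the infima of
    different players are approached at different states.\<close>
  have types: "restrict (\<lambda>j. ttype \<A> t j (w j)) J \<in> X" if "\<And>j. j \<in> J \<Longrightarrow> w j \<in> \<Omega>" for w
    unfolding X_def using that by (intro tuple_minus_prod ne ba_conv_superset) (auto simp: S_def)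
  \<comment> \<open>Passing from closed hulls to hulls shrinks the set, so the type stays outside
    its closure.\<close>
  have "X \<subseteq> tuple_minus J (cone_prod J (PiT \<Omega> \<A> t)) (cone_diag J (PiT_minus \<Omega> \<A> t i0 \<omega>0))"
    unfolding X_def PiT_def PiT_minus_def
    using ba_conv_subset_closure S R J
    by (intro tuple_minus_cone_mono) (auto simp: S_def R_def \<tau>_def)
  from closure_of_mono[OF this] notin
  have "restrict (\<lambda>_. \<tau>) J \<notin> product_topology (\<lambda>_. weakstar \<Omega> \<A>) J closure_of X"
    unfolding J_def \<tau>_def by blast
  moreover have "X \<noteq> {}" using types[of "\<lambda>_. \<omega>0"] I(4) by auto
  moreover have "X \<subseteq> J \<rightarrow>\<^sub>E ba \<Omega> \<A>"
    unfolding X_def using S J R by (intro tuple_minus_cone_subset ba_conv_subset) auto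
  moreover have "restrict (\<lambda>_. \<tau>) J \<in> J \<rightarrow>\<^sub>E ba \<Omega> \<A>" using ty I by (auto simp: \<tau>_def)
  moreover have "restrict (\<lambda>j E. x j E + y j E) J \<in> X" if "x \<in> X" "y \<in> X" for x y
    using that tuple_minus_add[where S = S, OF ne] unfolding X_def by blast
  moreover have "restrict (\<lambda>j E. a * x j E) J \<in> X" if "x \<in> X" "a \<ge> 0" for x a
    using that tuple_minus_scale[where S = S, OF ne] unfolding X_def by blast
  ultimately have "\<exists>h. (\<forall>j\<in>J. h j \<in> Bfun \<Omega> \<A>) \<and> (\<forall>x\<in>X. 0 \<le> (\<Sum>j\<in>J. FI (x j) (h j))) \<and>
      (\<Sum>j\<in>J. FI (restrict (\<lambda>_. \<tau>) J j) (h j)) < 0"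
    by (intro cone_separation J(1))
  then obtain h where h: "\<And>j. j \<in> J \<Longrightarrow> h j \<in> Bfun \<Omega> \<A>"
    and hX: "\<And>x. x \<in> X \<Longrightarrow> 0 \<le> (\<Sum>j\<in>J. FI (x j) (h j))"
    and h\<tau>: "(\<Sum>j\<in>J. FI (restrict (\<lambda>_. \<tau>) J j) (h j)) < 0"
    by blast
  have h\<tau>: "(\<Sum>j\<in>J. FI \<tau> (h j)) < 0" using h\<tau> by simp
  define m where "m j = (INF \<omega>\<in>\<Omega>. FI (ttype \<A> t j \<omega>) (h j))" for j
  have bdd: "bdd_below ((\<lambda>\<omega>. FI (ttype \<A> t j \<omega>) (h j)) ` \<Omega>)" if j: "j \<in> J" for j
  proof -
    have jN: "j \<in> N" using J(2)[OF j] I(2) by auto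
    obtain C where "\<forall>\<mu>\<in>ba \<Omega> \<A>. (\<forall>E\<in>\<A>. \<bar>\<mu> E\<bar> \<le> 1) \<longrightarrow> \<bar>FI \<mu> (h j)\<bar> \<le> C"
      using fa_integral_bounded[OF h[OF j]] by blast
    then have "\<bar>FI (ttype \<A> t j \<omega>) (h j)\<bar> \<le> C" if "\<omega> \<in> \<Omega>" for \<omega>
      using type_space_ttype(1,2)[OF T jN that] by blast
    then show ?thesis by (intro bdd_belowI2[of _ "- C"]) (simp add: abs_le_iff minus_le_iff)
  qed
  have m: "m j \<le> FI (ttype \<A> t j \<omega>) (h j)" if "j \<in> J" "\<omega> \<in> \<Omega>" for j \<omega>
    unfolding m_def using bdd that by (intro cINF_lower) auto
  have m_sum: "0 \<le> (\<Sum>j\<in>J. m j)"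
  proof (rule field_le_epsilon)
    fix e :: real assume e: "e > 0"
    \<comment> \<open>The infima need not be attained, so each player in \<open>J\<close> gets a
      type within \<open>e'\<close> of the infimum, for a total excess of at most \<open>e\<close>.
      The summand 1 in the denominator covers an empty \<open>J\<close>.\<close>
    define e' where "e' = e / (real (card J) + 1)"
    have "e' > 0" using e by (simp add: e'_def add_nonneg_pos)
    have "\<exists>\<omega>\<in>\<Omega>. FI (ttype \<A> t j \<omega>) (h j) < m j + e'" if "j \<in> J" for j
    proof -
      have "m j < m j + e'" using \<open>e' > 0\<close> by simp
      then show ?thesis unfolding m_def
        using cInf_lessD[of "(\<lambda>\<omega>. FI (ttype \<A> t j \<omega>) (h j)) ` \<Omega>"] I(4) by blast
    qed
    then obtain w where w: "\<And>j. j \<in> J \<Longrightarrow> w j \<in> \<Omega>"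
      "\<And>j. j \<in> J \<Longrightarrow> FI (ttype \<A> t j (w j)) (h j) < m j + e'" by metis
    have "0 \<le> (\<Sum>j\<in>J. FI (ttype \<A> t j (w j)) (h j))" using hX[OF types[OF w(1)]] by simp
    also have "\<dots> \<le> (\<Sum>j\<in>J. m j + e')" using w(2) by (intro sum_mono less_imp_le) auto
    also have "\<dots> = (\<Sum>j\<in>J. m j) + real (card J) * e'" by (simp add: sum.distrib)
    also have "real (card J) * e' \<le> e" using e by (simp add: e'_def field_simps)
    finally show "0 \<le> (\<Sum>j\<in>J. m j) + e" by simp
  qed
  \<comment> \<open>Player \<open>i0\<close> receives the sum of the \<open>m j\<close> so that the
    bet sums to zero. The functions are written with \<open>+\<close> and \<open>- 1 *\<close> to
    match the linearity laws.\<close>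
  define f where "f i = (if i = i0 then (\<lambda>\<omega>. (\<Sum>j\<in>J. m j) + - 1 * (\<Sum>j\<in>J. h j \<omega>)) else (\<lambda>\<omega>. - m i + h i \<omega>))" for i
  have fB: "f i \<in> Bfun \<Omega> \<A>" if "i \<in> I" for i
  proof (cases "i = i0")
    case True
    have "(\<lambda>\<omega>. (\<Sum>j\<in>J. m j) + - 1 * (\<Sum>j\<in>J. h j \<omega>)) \<in> Bfun \<Omega> \<A>"
      using h J(1) by (intro Bfun_add Bfun_const Bfun_scale Bfun_sum) auto
    then show ?thesis using True by (simp add: f_def)
  next
    case False
    then have "(\<lambda>\<omega>. - m i + h i \<omega>) \<in> Bfun \<Omega> \<A>"
      using that h by (intro Bfun_add Bfun_const) (auto simp: J_def)
    then show ?thesis using False by (simp add: f_def)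
  qed
  have "(\<Sum>i\<in>I. f i \<omega>) = 0" for \<omega>
  proof -
    have "(\<Sum>i\<in>I. f i \<omega>) = f i0 \<omega> + (\<Sum>j\<in>J. f j \<omega>)"
      unfolding J_def by (rule sum.remove[OF I(1,3)])
    also have "(\<Sum>j\<in>J. f j \<omega>) = (\<Sum>j\<in>J. - m j + h j \<omega>)"
      using J(3) by (intro sum.cong) (auto simp: f_def)
    finally show ?thesis by (simp add: f_def sum_subtractf)
  qed
  then have bet: "is_bet \<Omega> \<A> N I f" using I fB by (simp add: is_bet_def)
  have FIj: "FI (ttype \<A> t j \<omega>) (f j) = FI (ttype \<A> t j \<omega>) (h j) - m j" if "j \<in> J" "\<omega> \<in> \<Omega>" for j \<omega>
  proof -
    have 1: "ttype \<A> t j \<omega> \<in> ba \<Omega> \<A>" "ttype \<A> t j \<omega> \<Omega> = 1"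
      using that ty ty1 J(2) by auto
    have "f j = (\<lambda>\<omega>. - m j + h j \<omega>)" using J(3)[OF that(1)] by (simp add: f_def)
    then show ?thesis
      by (simp only: fa_integral_add[OF 1(1) Bfun_const h[OF that(1)]] fa_integral_const[OF 1(1)] 1(2))
  qed
  have FI0: "FI (ttype \<A> t i0 \<omega>) (f i0) = (\<Sum>j\<in>J. m j) - (\<Sum>j\<in>J. FI (ttype \<A> t i0 \<omega>) (h j))"
    if "\<omega> \<in> \<Omega>" for \<omega>
  proof -
    have 1: "ttype \<A> t i0 \<omega> \<in> ba \<Omega> \<A>" "ttype \<A> t i0 \<omega> \<Omega> = 1"
      using that ty ty1 I by auto
    have 2: "(\<lambda>\<omega>. \<Sum>j\<in>J. h j \<omega>) \<in> Bfun \<Omega> \<A>" using J(1) h by (intro Bfun_sum) auto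
    have "f i0 = (\<lambda>\<omega>. (\<Sum>j\<in>J. m j) + - 1 * (\<Sum>j\<in>J. h j \<omega>))" by (simp add: f_def)
    then have "FI (ttype \<A> t i0 \<omega>) (f i0)
        = (\<Sum>j\<in>J. m j) + - 1 * FI (ttype \<A> t i0 \<omega>) (\<lambda>\<omega>. \<Sum>j\<in>J. h j \<omega>)"
      by (simp only: fa_integral_add[OF 1(1) Bfun_const Bfun_scale[OF 2]] fa_integral_const[OF 1(1)]
          fa_integral_scale[OF 1(1) 2] 1(2) mult_1_right)
    also have "FI (ttype \<A> t i0 \<omega>) (\<lambda>\<omega>. \<Sum>j\<in>J. h j \<omega>) = (\<Sum>j\<in>J. FI (ttype \<A> t i0 \<omega>) (h j))"
      using J(1) h by (intro fa_integral_sum 1) auto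
    finally show ?thesis by simp
  qed
  have pos: "FI (ttype \<A> t i0 \<omega>0) (f i0) > 0"
    using FI0[OF I(4)] h\<tau> m_sum by (simp add: \<tau>_def)
  have nn: "FI (ttype \<A> t i \<omega>) (f i) \<ge> 0" if "i \<in> I" "\<omega> \<in> \<Omega>" for i \<omega>
  proof (cases "i = i0")
    case False
    then show ?thesis using FIj m that by (simp add: J_def)
  next
    case i: True
    show ?thesis
    \<comment> \<open>The separated type \<tau> itself is excluded from \<open>R\<close>; for it the
      strict inequality \<open>pos\<close> applies. Every other type of \<open>i0\<close> lies in
      \<open>R\<close>, where the diagonal cone gives the sign.\<close>
    proof (cases "ttype \<A> t i0 \<omega> = \<tau>")
      case True
      then show ?thesis using pos i by (simp add: \<tau>_def)
    next
      case False
      let ?y = "ttype \<A> t i0 \<omega>"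
      have "?y \<in> ba_conv R" using False that by (intro ba_conv_superset) (auto simp: R_def)
      then have "restrict (\<lambda>_ E. - ?y E) J \<in> X"
        unfolding X_def by (rule tuple_minus_diag[where S = S, OF ne])
      from hX[OF this]
      have "0 \<le> (\<Sum>j\<in>J. FI (\<lambda>E. (- 1) * ?y E) (h j))" by simp
      also have "\<dots> = (\<Sum>j\<in>J. (- 1) * FI ?y (h j))"
        using ty that i h by (intro sum.cong fa_integral_measure_scale) auto
      finally show ?thesis using FI0[OF that(2)] m_sum i by (simp add: sum_negf)
    qed
  qed
  have "t i \<omega> \<Omega> = 1" if "i \<in> I" "\<omega> \<in> \<Omega>" for i \<omega>
    using ty1[OF that] space_in by (simp add: ttype_def on_field_def)
  then have "cc_component \<Omega> \<A> t I \<Omega>"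
    unfolding cc_component_def using I(4) space_in by (auto intro!: bexI[of _ \<Omega>])
  moreover have "{\<omega>' \<in> \<Omega>. \<forall>i\<in>I. FI (ttype \<A> t i \<omega>') (f i) \<ge> 0} = \<Omega>" using nn by auto
  ultimately have "acceptable_bet \<Omega> \<A> N t I f"
    using bet pos I unfolding acceptable_bet_def commonly_certain_def by auto
  then show ?thesis by blast
qed

theorem theorem6:
  fixes \<Omega> :: "'w set" and \<A> :: "'w set set" and N :: "'i set"
    and \<M> :: "'i \<Rightarrow> 'w set set" and t :: "'i \<Rightarrow> 'w \<Rightarrow> 'w set \<Rightarrow> real"
  assumes "type_space \<Omega> \<A> N \<M> t"
  shows "(strongly_consistent \<Omega> \<A> N t \<and> \<not> (\<exists>I f. acceptable_bet \<Omega> \<A> N t I f))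
       \<or> (\<not> strongly_consistent \<Omega> \<A> N t \<and> (\<exists>I f. acceptable_bet \<Omega> \<A> N t I f))"
  using acceptable_bet_not_strongly_consistent[OF assms]
    not_strongly_consistent_acceptable_bet[OF assms] by blast

end
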